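(* If $k\geq l\geq 2$ are integers, then $\mathrm{ex}(n,C_{2l+1},\textnormal{rainbow-}C_{2k+1})=\Theta(n^{2l-1})$.
   Context: A proper edge-colouring of a graph assigns colours to edges so that any two edges sharing a vertex receive different colours. A subgraph of an edge-coloured graph is rainbow if all its edges have distinct colours. $\mathrm{ex}(n,H,\textnormal{rainbow-}F)$ denotes the maximum number of copies of $H$ in a properly edge-coloured graph on $n$ vertices containing no rainbow subgraph isomorphic to $F$. $C_m$ denotes the cycle of length $m$. Implied constants may depend on $k$ and $l$. *)

theory Defs
  imports Complex_Main "HOL-Library.Landau_Symbols"
begin

text \<open>A graph is a pair of a vertex set and a set of edges, an edge being a set of two vertices.\<close>

type_synonym 'a graph = "'a set \<times> 'a set set"

abbreviation verts :: "'a graph \<Rightarrow> 'a set" where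
  "verts G \<equiv> fst G"

abbreviation edges :: "'a graph \<Rightarrow> 'a set set" where
  "edges G \<equiv> snd G"

definition simple_graph :: "'a graph \<Rightarrow> bool" where
  "simple_graph G \<longleftrightarrow> finite (verts G) \<and> (\<forall>e\<in>edges G. e \<subseteq> verts G \<and> card e = 2)"

definition subgraph :: "'a graph \<Rightarrow> 'a graph \<Rightarrow> bool" where
  "subgraph S G \<longleftrightarrow> simple_graph S \<and> verts S \<subseteq> verts G \<and> edges S \<subseteq> edges G"

definition graph_iso :: "'a graph \<Rightarrow> 'b graph \<Rightarrow> bool" where
  "graph_iso G H \<longleftrightarrow> (\<exists>f. bij_betw f (verts G) (verts H) \<and> edges H = (\<lambda>e. f ` e) ` edges G)"

text \<open>Copies are unlabelled and not necessarily induced: the subgraphs isomorphic to \<open>H\<close>.\<close>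

definition copies :: "'b graph \<Rightarrow> 'a graph \<Rightarrow> 'a graph set" where
  "copies H G = {S. subgraph S G \<and> graph_iso H S}"

text \<open>The cycle of length \<open>m\<close>; intended for \<open>m \<ge> 3\<close>.\<close>

definition cycle_graph :: "nat \<Rightarrow> nat graph" where
  "cycle_graph m = ({..<m}, (\<lambda>i. {i, Suc i mod m}) ` {..<m})"

definition proper_edge_colouring :: "'a graph \<Rightarrow> ('a set \<Rightarrow> 'c) \<Rightarrow> bool" where
  "proper_edge_colouring G c \<longleftrightarrow>
     (\<forall>e\<in>edges G. \<forall>e'\<in>edges G. e \<noteq> e' \<and> e \<inter> e' \<noteq> {} \<longrightarrow> c e \<noteq> c e')"

definition rainbow :: "('a set \<Rightarrow> 'c) \<Rightarrow> 'a graph \<Rightarrow> bool" where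
  "rainbow c S \<longleftrightarrow> inj_on c (edges S)"

text \<open>
  Since graphs are finite, taking vertices and colours from the natural numbers is no restriction.
  The set under \<open>Max\<close> is always finite, and it is nonempty if \<open>F\<close> has an edge
  (see the two lemmas below).
\<close>

definition ex_counts :: "nat \<Rightarrow> 'a graph \<Rightarrow> 'b graph \<Rightarrow> nat set" where
  "ex_counts n H F =
     {card (copies H G) | (G :: nat graph) (c :: nat set \<Rightarrow> nat).
        simple_graph G \<and> card (verts G) = n \<and> proper_edge_colouring G c \<and>
        \<not> (\<exists>S\<in>copies F G. rainbow c S)}"

definition ex_rainbow :: "nat \<Rightarrow> 'a graph \<Rightarrow> 'b graph \<Rightarrow> nat" where
  "ex_rainbow n H F = Max (ex_counts n H F)"

lemma finite_ex_counts: "finite (ex_counts n H F)"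
proof -
  have "card (copies H G) \<le> 2 ^ n * 2 ^ 2 ^ n"
    if "simple_graph G" "card (verts G) = n" for G :: "nat graph"
  proof -
    have fin: "finite (verts G)" using that by (simp add: simple_graph_def)
    have "copies H G \<subseteq> Pow (verts G) \<times> Pow (Pow (verts G))"
      using that by (auto simp: copies_def subgraph_def simple_graph_def) blast
    then have "card (copies H G) \<le> card (Pow (verts G) \<times> Pow (Pow (verts G)))"
      using fin by (intro card_mono) auto
    then show ?thesis
      using fin that by (simp add: card_cartesian_product card_Pow)
  qed
  then have "ex_counts n H F \<subseteq> {..2 ^ n * 2 ^ 2 ^ n}"
    by (auto simp: ex_counts_def)
  then show ?thesis using finite_subset by blast
qed

lemma ex_counts_nonempty:
  assumes "edges F \<noteq> {}"
  shows "ex_counts n H F \<noteq> {}"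
proof -
  let ?G = "({..<n}, {}) :: nat graph"
  have "copies F ?G = {}"
    using assms by (auto simp: copies_def subgraph_def graph_iso_def)
  then have "card (copies H ?G) \<in> ex_counts n H F"
    unfolding ex_counts_def mem_Collect_eq
    by (intro exI[of _ ?G] exI[of _ "\<lambda>_. 0"])
      (simp add: simple_graph_def proper_edge_colouring_def)
  then show ?thesis by blast
qed

lemma simple_graph_cycle_graph:
  assumes "m \<ge> 3"
  shows "simple_graph (cycle_graph m)"
  using assms by (auto simp: simple_graph_def cycle_graph_def card_insert_if mod_Suc)

end

(* Upper bound. Put m = 2l+1 and call a pair of vertices heavy if it has at least D common
   neighbours, D a large constant. In an m-cycle v_0 ... v_{m-1} for which two non-adjacent vertices
   sit between non-heavy pairs, these two are determined up to D^2 choices by the others, so there are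
   O(n^{m-2}) such cycles. In every other cycle, up to rotation, v_i v_{i+2} is heavy for i <= m-3. Fix
   a = v_0, b = v_4 and v_5, ..., v_{m-1}. If more than 3 D^2 n triples (x, y, z) = (v_1, v_2, v_3)
   complete a cycle then either there are many pairs (x, z), hence a relation of heavy pairs with all
   degrees at least D, or the edges xy, yz contain a graph of minimum degree D. Following heavy pairs
   (two edges each, through fresh common neighbours) or edges greedily gives rainbow paths from a to b
   of length 4 + 2 (k - l); continuing through fresh common neighbours of v_4, v_6, ..., v_{m-1} closes
   a rainbow cycle of length 2k+1 with the single old edge v_{m-1} v_0.

   Lower bound. Take vertex classes A1, A2, B, A', B' of equal size with all edges between A1 + A2 and
   B and between A' and B', and perfect matchings A1-A' and A2-B' in one common colour, all other
   edges having their own colour. Every odd cycle uses at least two matching edges. *)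
theory Submission
  imports Defs "HOL-Library.FuncSet" "HOL-Library.Nat_Bijection"
begin

subsection \<open>Upper bound\<close>

lemma card_le_fibres:
  assumes "finite A" and "\<And>x. x \<in> A \<Longrightarrow> card {x' \<in> A. f x' = f x} \<le> N"
  shows "card A \<le> card (f ` A) * N"
proof -
  have "card A = card (\<Union>y\<in>f ` A. {x' \<in> A. f x' = y})" by (rule arg_cong [where f = card]) auto
  also have "\<dots> \<le> (\<Sum>y\<in>f ` A. card {x' \<in> A. f x' = y})"
    by (rule card_UN_le) (simp add: assms(1))
  also have "\<dots> \<le> (\<Sum>y\<in>f ` A. N)" by (intro sum_mono) (use assms(2) in auto)
  finally show ?thesis by simp
qed

text \<open>Dropping a fibre of \<open>f\<close> with fewer than \<open>D\<close> elements also
  drops one value of \<open>f\<close>. The right-hand side falls by at least \<open>D\<close> while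
  fewer than \<open>D\<close> elements are lost, so the strict inequality survives.\<close>

lemma remove_small_fibre:
  assumes "finite T" and "card T > D * card (f ` T) + D' * card (g ` T)"
    and "t \<in> T" and "card {t' \<in> T. f t' = f t} < D"
  defines "T2 \<equiv> {t' \<in> T. f t' \<noteq> f t}"
  shows "card T2 > D * card (f ` T2) + D' * card (g ` T2)" and "card T2 < card T"
proof -
  have fin: "finite T2" using assms(1) by (simp add: T2_def)
  have "f t \<in> f ` T" "f t \<notin> f ` T2" "f ` T2 \<subseteq> f ` T" using assms(3) by (auto simp: T2_def)
  then have "card (f ` T2) < card (f ` T)"
    using assms(1) by (intro psubset_card_mono) auto
  then have "D * card (f ` T2) + D \<le> D * card (f ` T)"
    using mult_le_mono2 [of "Suc (card (f ` T2))" "card (f ` T)" D] by simp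
  moreover have "D' * card (g ` T2) \<le> D' * card (g ` T)"
    using assms(1) unfolding T2_def by (intro mult_le_mono2 card_mono) auto
  moreover have "card T = card T2 + card {t' \<in> T. f t' = f t}"
    unfolding T2_def using assms(1)
    by (subst card_Un_disjoint [symmetric]) (auto intro!: arg_cong [where f = card])
  ultimately show "card T2 > D * card (f ` T2) + D' * card (g ` T2)" using assms(2,4) by linarith
  show "card T2 < card T" using assms(1,3) unfolding T2_def by (intro psubset_card_mono) auto
qed

text \<open>Small fibres of \<open>f\<close> or \<open>g\<close> are deleted as long as there are
  any. The strict inequality is kept, so the set never becomes empty. This is the analogue of
  passing to a subgraph of large minimum degree.\<close>

lemma exists_subset_large_fibres:
  assumes "finite T" and "card T > D * card (f ` T) + D' * card (g ` T)"
  shows "\<exists>T'\<subseteq>T. T' \<noteq> {} \<and>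
    (\<forall>t\<in>T'. D \<le> card {t' \<in> T'. f t' = f t} \<and> D' \<le> card {t' \<in> T'. g t' = g t})"
  using assms
proof (induction "card T" arbitrary: T rule: less_induct)
  case less
  have nonempty: "T \<noteq> {}" using less.prems(2) by auto
  consider t where "t \<in> T" "card {t' \<in> T. f t' = f t} < D"
    | t where "t \<in> T" "card {t' \<in> T. g t' = g t} < D'"
    | "\<forall>t\<in>T. D \<le> card {t' \<in> T. f t' = f t} \<and> D' \<le> card {t' \<in> T. g t' = g t}"
    by (meson not_less)
  then show ?case
  proof cases
    case (1 t)
    note small = remove_small_fibre [OF less.prems 1]
    have "finite {t' \<in> T. f t' \<noteq> f t}" using less.prems(1) by simp
    from less.hyps [OF small(2) this small(1)] show ?thesis by blast
  next
    case (2 t)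
    \<comment> \<open>The deletion lemma acts on the first of the two maps, so the roles of
      \<open>f\<close> and \<open>g\<close> are exchanged.\<close>
    have "card T > D' * card (g ` T) + D * card (f ` T)" using less.prems(2) by simp
    note small = remove_small_fibre [OF less.prems(1) this 2]
    have "finite {t' \<in> T. g t' \<noteq> g t}" using less.prems(1) by simp
    from less.hyps [OF small(2) this] small(1) show ?thesis by (simp add: add.commute) blast
  next
    case 3
    then show ?thesis using nonempty by blast
  qed
qed

lemma exists_mem_avoiding:
  assumes "finite B" and "card B < card S"
  shows "\<exists>x\<in>S. x \<notin> B"
proof (rule ccontr)
  assume "\<not> ?thesis"
  then have "S \<subseteq> B" by blast
  then show False using assms card_mono [of B S] by simp
qed

section \<open>Walks as vertex lists\<close>

fun walk_edges :: "'a list \<Rightarrow> 'a set list" where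
  "walk_edges (x # y # p) = {x, y} # walk_edges (y # p)"
| "walk_edges p = []"

lemma walk_edges_conv: "walk_edges p = map (\<lambda>i. {p ! i, p ! Suc i}) [0..<length p - 1]"
proof (induction p rule: walk_edges.induct)
  case (1 x y p)
  have "[0..<Suc (length p)] = 0 # map Suc [0..<length p]"
    by (metis map_Suc_upt upt_conv_Cons zero_less_Suc)
  then show ?case using 1 by (simp del: upt_Suc)
qed auto

lemma length_walk_edges [simp]: "length (walk_edges p) = length p - 1"
  by (simp add: walk_edges_conv)

lemma walk_edges_append: "walk_edges (p @ [x, y]) = walk_edges (p @ [x]) @ [{x, y}]"
  by (induction p rule: walk_edges.induct) auto

lemma walk_edges_rev: "walk_edges (rev p) = rev (walk_edges p)"
  by (induction p rule: walk_edges.induct) (auto simp: walk_edges_append insert_commute)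

section \<open>Rainbow paths in a properly coloured graph\<close>

locale coloured_graph =
  fixes G :: "'a graph" and c :: "'a set \<Rightarrow> 'c"
  assumes simple: "simple_graph G" and proper: "proper_edge_colouring G c"
begin

lemma finite_verts [simp]: "finite (verts G)"
  using simple by (simp add: simple_graph_def)

lemma edge_verts: "{x, y} \<in> edges G \<Longrightarrow> x \<in> verts G \<and> y \<in> verts G \<and> x \<noteq> y"
  using simple by (fastforce simp: simple_graph_def)

lemma colour_neq:
  assumes "{x, y} \<in> edges G" "{x, z} \<in> edges G" "y \<noteq> z"
  shows "c {x, y} \<noteq> c {x, z}"
proof -
  have "{x, y} \<noteq> {x, z}" using assms by (auto simp: doubleton_eq_iff)
  then show ?thesis using assms(1,2) proper by (auto simp: proper_edge_colouring_def)
qed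

lemma finite_coloured_neighbours: "finite {z. {x, z} \<in> edges G \<and> c {x, z} \<in> K}"
  by (rule finite_subset [OF _ finite_verts]) (use edge_verts in auto)

lemma card_coloured_neighbours:
  assumes "finite K"
  shows "card {z. {x, z} \<in> edges G \<and> c {x, z} \<in> K} \<le> card K"
  by (rule card_inj_on_le [where f = "\<lambda>z. c {x, z}"])
    (use colour_neq assms in \<open>auto simp: inj_on_def\<close>)

definition common_neighbours :: "'a \<Rightarrow> 'a \<Rightarrow> 'a set" where
  "common_neighbours x z = {u. {x, u} \<in> edges G \<and> {u, z} \<in> edges G}"

lemma common_neighbours_commute: "common_neighbours x z = common_neighbours z x"
  by (auto simp: common_neighbours_def insert_commute)

lemma finite_common_neighbours: "finite (common_neighbours x z)"
  by (rule finite_subset [OF _ finite_verts]) (use edge_verts in \<open>auto simp: common_neighbours_def\<close>)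

text \<open>\<open>A\<close> and \<open>K\<close> are the vertices and colours reserved for the rest
  of the cycle. Paths grow by prepending, so \<open>hd p\<close> is the active end and
  \<open>last p\<close> stays fixed.\<close>

definition rainbow_path :: "'a set \<Rightarrow> 'c set \<Rightarrow> 'a list \<Rightarrow> bool" where
  "rainbow_path A K p \<longleftrightarrow> distinct p \<and> set p \<inter> A = {} \<and> set (walk_edges p) \<subseteq> edges G \<and>
     distinct (map c (walk_edges p)) \<and> c ` set (walk_edges p) \<inter> K = {}"

lemma rainbow_path_mono:
  "rainbow_path A K p \<Longrightarrow> A' \<subseteq> A \<Longrightarrow> K' \<subseteq> K \<Longrightarrow> rainbow_path A' K' p"
  unfolding rainbow_path_def by blast

lemma rainbow_path_rev: "rainbow_path A K (rev p) \<longleftrightarrow> rainbow_path A K p"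
  by (simp add: rainbow_path_def walk_edges_rev rev_map [symmetric])

lemma rainbow_path_Cons:
  "rainbow_path A K (z # x # p) \<longleftrightarrow> rainbow_path A K (x # p) \<and> z \<notin> set (x # p) \<and> z \<notin> A \<and>
     {z, x} \<in> edges G \<and> c {z, x} \<notin> K \<union> c ` set (walk_edges (x # p))"
  by (auto simp: rainbow_path_def)

lemma rainbow_path_Cons':
  "rainbow_path A K p \<Longrightarrow> p \<noteq> [] \<Longrightarrow> z \<notin> set p \<Longrightarrow> z \<notin> A \<Longrightarrow> {hd p, z} \<in> edges G \<Longrightarrow>
    c {hd p, z} \<notin> K \<union> c ` set (walk_edges p) \<Longrightarrow> rainbow_path A K (z # p)"
  by (cases p) (auto simp: rainbow_path_Cons insert_commute)

abbreviation used_colours :: "'c set \<Rightarrow> 'a list \<Rightarrow> 'c set" where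
  "used_colours K p \<equiv> K \<union> c ` set (walk_edges p)"

lemma card_used_colours: "card (used_colours K p) \<le> card K + length p"
proof -
  have "card (c ` set (walk_edges p)) \<le> length p"
    using card_length [of "map c (walk_edges p)"] by simp
  then show ?thesis using card_Un_le [of K "c ` set (walk_edges p)"] by linarith
qed

text \<open>\<open>B\<close> collects the bad choices for a next vertex. At a fixed vertex each
  colour occurs on at most one edge, so the colours of \<open>K\<close> and of the path spoil at
  most \<open>card K + length p\<close> neighbours of \<open>x\<close> and as many of
  \<open>z\<close>; the vertices of \<open>p\<close> give the third \<open>length p\<close>.\<close>

lemma card_blocked:
  fixes x z :: 'a and p :: "'a list"
  assumes "finite A" "finite K"
  defines "B \<equiv> A \<union> set p \<union> {u. {x, u} \<in> edges G \<and> c {x, u} \<in> used_colours K p}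
    \<union> {u. {z, u} \<in> edges G \<and> c {z, u} \<in> used_colours K p}"
  shows "finite B" and "card B \<le> card A + 2 * card K + 3 * length p"
proof -
  let ?B = "\<lambda>x. {u. {x, u} \<in> edges G \<and> c {x, u} \<in> used_colours K p}"
  show "finite B" unfolding B_def
    by (intro finite_UnI finite_coloured_neighbours finite_set assms)
  have "card (?B y) \<le> card K + length p" for y
    using card_coloured_neighbours [of "used_colours K p" y] card_used_colours [of K p] assms(2)
    by (simp add: le_trans)
  from this [of x] this [of z] card_length [of p]
  show "card B \<le> card A + 2 * card K + 3 * length p"
    unfolding B_def
    using card_Un_le [of A "set p"] card_Un_le [of "A \<union> set p" "?B x"]
      card_Un_le [of "A \<union> set p \<union> ?B x" "?B z"] by linarith
qed

text \<open>Some common neighbour \<open>u\<close> is not blocked. The two new edges meet in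
  \<open>u\<close> and differ in colour by properness; all other clashes are excluded by the choice
  of \<open>u\<close>.\<close>

lemma extend_via_common_neighbour:
  assumes "rainbow_path A K p" "p \<noteq> []" "finite A" "finite K" "z \<notin> A" "z \<notin> set p"
    and "card A + 2 * card K + 3 * length p < card (common_neighbours (hd p) z)"
  shows "\<exists>u. rainbow_path A K (z # u # p)"
proof -
  let ?x = "hd p"
  obtain u where u: "u \<in> common_neighbours ?x z"
    and unblocked: "u \<notin> A \<union> set p \<union> {u. {?x, u} \<in> edges G \<and> c {?x, u} \<in> used_colours K p}
      \<union> {u. {z, u} \<in> edges G \<and> c {z, u} \<in> used_colours K p}"
    using exists_mem_avoiding [OF card_blocked(1) order_le_less_trans [OF card_blocked(2) assms(7)]]
      assms(3,4) by blast
  have edges: "{?x, u} \<in> edges G" "{u, z} \<in> edges G" "{z, u} \<in> edges G"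
    using u by (auto simp: common_neighbours_def insert_commute)
  have "?x \<noteq> z" using assms(2,6) by auto
  then have "c {u, ?x} \<noteq> c {u, z}"
    using edges by (intro colour_neq) (auto simp: insert_commute)
  moreover have p: "p = ?x # tl p" using assms(2) by simp
  have "rainbow_path A K (u # p)"
    using assms(1,2) unblocked edges by (intro rainbow_path_Cons') auto
  moreover have "set (walk_edges (u # p)) = insert {u, ?x} (set (walk_edges p))"
    by (subst (1 2) p) simp
  moreover have "z \<noteq> u" "c {u, z} \<notin> used_colours K p"
    using edges unblocked by (auto dest: edge_verts simp: insert_commute)
  ultimately have "rainbow_path A K (z # u # p)"
    using assms(5,6) edges(2) by - (rule rainbow_path_Cons', auto)
  then show ?thesis by blast
qed

section \<open>Walking along heavy pairs and edges\<close>

definition heavy :: "nat \<Rightarrow> 'a \<Rightarrow> 'a \<Rightarrow> bool" where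
  "heavy D x z \<longleftrightarrow> D \<le> card (common_neighbours x z)"

lemma heavy_commute: "heavy D x z \<longleftrightarrow> heavy D z x"
  by (simp add: heavy_def common_neighbours_commute)

text \<open>\<open>d\<close> is the number of edges a path spends on one step along \<open>W\<close>.\<close>

definition linked :: "nat \<Rightarrow> nat \<Rightarrow> ('a \<times> 'a) set \<Rightarrow> bool" where
  "linked D d W \<longleftrightarrow> (\<forall>(x, z)\<in>W. D \<le> card (W `` {x}) \<and> D \<le> card (W\<inverse> `` {z}) \<and>
     (d = 1 \<and> {x, z} \<in> edges G \<or> d = 2 \<and> heavy D x z))"

lemma linked_converse: "linked D d W \<Longrightarrow> linked D d (W\<inverse>)"
  unfolding linked_def by (auto simp: insert_commute heavy_commute)

text \<open>The new end is chosen among many \<open>W\<close>-neighbours outside the blocked set.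
  Blocking with respect to \<open>b\<close> as well ensures that, whenever the new end is adjacent
  to \<open>b\<close>, the path can be finished by that edge.\<close>

lemma linked_step:
  assumes W: "linked D d W" and p: "rainbow_path A K p" "p \<noteq> []" "hd p \<in> Domain W"
    and fin: "finite A" "finite K" and b: "b \<in> A"
    and D: "card A + 2 * card K + 2 + 3 * length p < D"
  shows "\<exists>q. q \<noteq> [] \<and> rainbow_path A K q \<and> length q = length p + d \<and> last q = last p \<and>
    hd q \<in> Range W \<and> ({b, hd q} \<in> edges G \<longrightarrow> c {b, hd q} \<notin> used_colours K q)"
proof -
  let ?x = "hd p"
  obtain z0 where z0: "(?x, z0) \<in> W" using p(3) by blast
  then have "D \<le> card (W `` {?x})" using W by (auto simp: linked_def)
  then have "card A + 2 * card K + 3 * length p < card (W `` {?x})" using D by linarith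
  from exists_mem_avoiding [OF card_blocked(1) order_le_less_trans [OF card_blocked(2) this]]
  obtain z where xz: "(?x, z) \<in> W" and
    unblocked: "z \<notin> A \<union> set p \<union> {u. {?x, u} \<in> edges G \<and> c {?x, u} \<in> used_colours K p}
      \<union> {u. {b, u} \<in> edges G \<and> c {b, u} \<in> used_colours K p}"
    using fin by blast
  have "?x \<noteq> b" using p(1,2) b unfolding rainbow_path_def by (metis disjoint_iff hd_in_set)
  from W xz consider "d = 1" "{?x, z} \<in> edges G" | "d = 2" "heavy D ?x z"
    by (auto simp: linked_def)
  then show ?thesis
  proof cases
    case 1
    have "rainbow_path A K (z # p)"
      by (rule rainbow_path_Cons') (use 1 p unblocked in auto)
    moreover have "c {b, z} \<notin> used_colours K (z # p)" if bz: "{b, z} \<in> edges G"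
    proof -
      have "c {z, ?x} \<noteq> c {z, b}"
        using 1 bz \<open>?x \<noteq> b\<close> by (intro colour_neq) (auto simp: insert_commute)
      moreover have "set (walk_edges (z # p)) = insert {z, ?x} (set (walk_edges p))"
        using p(2) by (cases p) auto
      ultimately show ?thesis using unblocked bz by (auto simp: insert_commute)
    qed
    ultimately show ?thesis
      using 1 xz p(2) by (intro exI [of _ "z # p"]) auto
  next
    case 2
    \<comment> \<open>The colour of the edge to \<open>b\<close> is reserved while the common
      neighbour is chosen. This extra colour counts twice in the bound, whence the summand 2 in the
      hypothesis on \<open>D\<close>.\<close>
    let ?K = "if {b, z} \<in> edges G then insert (c {b, z}) K else K"
    have "rainbow_path A ?K p" using p(1) unblocked by (auto simp: rainbow_path_def)
    moreover have "card ?K \<le> card K + 1" using fin card_insert_le_m1 by (simp add: card_insert_if)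
    then have "card A + 2 * card ?K + 3 * length p < card (common_neighbours ?x z)"
      using D 2 by (auto simp: heavy_def)
    moreover have "finite ?K" "z \<notin> A" "z \<notin> set p" using fin unblocked by simp_all
    ultimately obtain u where u: "rainbow_path A ?K (z # u # p)"
      using extend_via_common_neighbour [OF _ p(2) fin(1)] by blast
    have "rainbow_path A K (z # u # p)" by (rule rainbow_path_mono [OF u]) auto
    moreover have "c {b, z} \<notin> used_colours K (z # u # p)" if "{b, z} \<in> edges G"
      using u unblocked that unfolding rainbow_path_def by auto
    ultimately show ?thesis
      using 2 xz p(2) by (intro exI [of _ "z # u # p"]) auto
  qed
qed

text \<open>Every step exchanges \<open>W\<close> and its converse. For even \<open>s\<close> the
  number \<open>Suc s\<close> of steps is odd and the walk ends in the range of \<open>W\<close>.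
  The hypothesis on \<open>D\<close> is the one needed for the last and longest step.\<close>

lemma linked_walk:
  assumes "linked D d W" "rainbow_path A K p" "p \<noteq> []" "hd p \<in> Domain W"
    and "finite A" "finite K" "b \<in> A"
    and "card A + 2 * card K + 2 + 3 * (length p + d * s) < D"
  shows "\<exists>q. q \<noteq> [] \<and> rainbow_path A K q \<and> length q = length p + d * Suc s \<and> last q = last p \<and>
    hd q \<in> (if even s then Range W else Domain W) \<and>
    ({b, hd q} \<in> edges G \<longrightarrow> c {b, hd q} \<notin> used_colours K q)"
  using assms
proof (induction s arbitrary: W p)
  case 0
  then show ?case using linked_step [of D d W A K p b] by simp
next
  case (Suc s)
  have "card A + 2 * card K + 2 + 3 * length p < D" using Suc.prems(8) by simp
  then obtain q where q: "q \<noteq> []" "rainbow_path A K q" "length q = length p + d" "last q = last p"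
    "hd q \<in> Domain (W\<inverse>)"
    using linked_step [of D d W A K p b] Suc.prems(1-7) by auto
  have "card A + 2 * card K + 2 + 3 * (length q + d * s) < D"
    using Suc.prems(8) q(3) by (simp add: algebra_simps)
  from Suc.IH [OF linked_converse [OF Suc.prems(1)] q(2,1,5) Suc.prems(5-7) this]
  show ?case using q(3,4) by (auto simp: algebra_simps)
qed

section \<open>Rainbow paths of prescribed length between two vertices\<close>

text \<open>Only vertices in the range of \<open>W\<close> are known to be adjacent to
  \<open>b\<close>, so the number of steps along \<open>W\<close> must be odd. Here it is
  \<open>r\<close>: three edges lead from \<open>a\<close> through \<open>w\<close> and
  \<open>y\<close> to \<open>x\<close>, then come \<open>2 * r\<close> edges along heavy pairs and
  one edge to \<open>b\<close>, in total \<open>2 * r + 4\<close>.\<close>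

lemma path_through_heavy_pairs_odd:
  assumes W: "linked D 2 W" and xz: "(x, z) \<in> W"
    and ends: "\<And>x z. (x, z) \<in> W \<Longrightarrow> {z, b} \<in> edges G"
    and heavy: "heavy D a y" and xy: "{x, y} \<in> edges G" "c {x, y} \<noteq> c0"
    and new: "a \<notin> insert b A" "x \<notin> insert b A" "y \<notin> insert b A" "x \<noteq> a" "y \<noteq> a" "b \<notin> A"
    and A: "finite A" and D: "card A + 20 + 6 * r < D" and r: "odd r"
  shows "\<exists>p. rainbow_path A {c0} p \<and> p \<noteq> [] \<and> hd p = b \<and> last p = a \<and> length p = 2 * r + 5"
proof -
  let ?A = "insert b A"
  have cA: "card ?A \<le> card A + 1" using A by (simp add: card_insert_if)
  \<comment> \<open>Both \<open>x\<close> and the colour of \<open>{x, y}\<close> are reserved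
    before \<open>w\<close> is chosen, so that this edge can follow.\<close>
  have "rainbow_path (insert x ?A) {c0, c {x, y}} [a]"
    using new by (auto simp: rainbow_path_def)
  moreover have "card (insert x ?A) + 2 * card {c0, c {x, y}} + 3 * length [a] < card (common_neighbours a y)"
    using D heavy A cA by (auto simp: heavy_def card_insert_if)
  ultimately obtain w where w: "rainbow_path (insert x ?A) {c0, c {x, y}} [y, w, a]"
    using extend_via_common_neighbour [of "insert x ?A" "{c0, c {x, y}}" "[a]" y] A new edge_verts [OF xy(1)]
    by auto
  have walk: "rainbow_path ?A {c0} (x # [y, w, a])"
  proof (rule rainbow_path_Cons')
    show "rainbow_path ?A {c0} [y, w, a]" by (rule rainbow_path_mono [OF w]) auto
  qed (use w xy new in \<open>auto simp: rainbow_path_def insert_commute\<close>)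
  obtain r' where r': "r = Suc r'" using r by (cases r) auto
  have "card ?A + 2 * card {c0} + 2 + 3 * (length [x, y, w, a] + 2 * r') < D"
    using D cA r' by simp
  from linked_walk [OF W walk _ _ _ _ _ this, of b]
  have "\<exists>q. q \<noteq> [] \<and> rainbow_path ?A {c0} q \<and> length q = length [x, y, w, a] + 2 * Suc r' \<and> last q = a \<and>
    hd q \<in> Range W \<and> ({b, hd q} \<in> edges G \<longrightarrow> c {b, hd q} \<notin> used_colours {c0} q)"
    using DomainI [OF xz] A r r' by simp
  then obtain q where q: "q \<noteq> []" "rainbow_path ?A {c0} q" "length q = length [x, y, w, a] + 2 * Suc r'" "last q = a"
    "hd q \<in> Range W" "{b, hd q} \<in> edges G \<longrightarrow> c {b, hd q} \<notin> used_colours {c0} q"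
    by blast
  have "{hd q, b} \<in> edges G" using q(5) ends by blast
  then have "rainbow_path A {c0} (b # q)"
  proof (intro rainbow_path_Cons')
    show "rainbow_path A {c0} q" by (rule rainbow_path_mono [OF q(2)]) auto
  qed (use q new in \<open>auto simp: rainbow_path_def insert_commute\<close>)
  then show ?thesis using q r' by (intro exI [of _ "b # q"]) auto
qed

text \<open>With \<open>r\<close> even, \<open>r + 1\<close> steps are taken: one edge from
  \<open>a\<close> to \<open>x\<close>, \<open>2 * r + 2\<close> edges along heavy pairs, one edge
  to \<open>b\<close>.\<close>

lemma path_through_heavy_pairs_even:
  assumes W: "linked D 2 W" and xz: "(x, z) \<in> W"
    and ends: "\<And>x z. (x, z) \<in> W \<Longrightarrow> {z, b} \<in> edges G"
    and ax: "{a, x} \<in> edges G" "c {a, x} \<noteq> c0"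
    and new: "a \<notin> insert b A" "x \<notin> insert b A" "b \<notin> A"
    and A: "finite A" and D: "card A + 20 + 6 * r < D" and r: "even r"
  shows "\<exists>p. rainbow_path A {c0} p \<and> p \<noteq> [] \<and> hd p = b \<and> last p = a \<and> length p = 2 * r + 5"
proof -
  let ?A = "insert b A"
  have cA: "card ?A \<le> card A + 1" using A by (simp add: card_insert_if)
  have walk: "rainbow_path ?A {c0} [x, a]"
    using new ax edge_verts [OF ax(1)] by (auto simp: rainbow_path_def insert_commute)
  have "card ?A + 2 * card {c0} + 2 + 3 * (length [x, a] + 2 * r) < D"
    using D cA by simp
  from linked_walk [OF W walk _ _ _ _ _ this, of b]
  have "\<exists>q. q \<noteq> [] \<and> rainbow_path ?A {c0} q \<and> length q = length [x, a] + 2 * Suc r \<and> last q = a \<and>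
    hd q \<in> Range W \<and> ({b, hd q} \<in> edges G \<longrightarrow> c {b, hd q} \<notin> used_colours {c0} q)"
    using DomainI [OF xz] A r by simp
  then obtain q where q: "q \<noteq> []" "rainbow_path ?A {c0} q" "length q = length [x, a] + 2 * Suc r" "last q = a"
    "hd q \<in> Range W" "{b, hd q} \<in> edges G \<longrightarrow> c {b, hd q} \<notin> used_colours {c0} q"
    by blast
  have "{hd q, b} \<in> edges G" using q(5) ends by blast
  then have "rainbow_path A {c0} (b # q)"
  proof (intro rainbow_path_Cons')
    show "rainbow_path A {c0} q" by (rule rainbow_path_mono [OF q(2)]) auto
  qed (use q new in \<open>auto simp: rainbow_path_def insert_commute\<close>)
  then show ?thesis using q by (intro exI [of _ "b # q"]) auto
qed

text \<open>One edge from \<open>a\<close> to \<open>x\<close>, then \<open>2 * r + 1\<close> single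
  edges of \<open>W\<close>, an odd number and so ending in the range of \<open>W\<close>, and
  finally two edges to \<open>b\<close> through a common neighbour. Parity of \<open>r\<close> does
  not matter here.\<close>

lemma path_through_edges:
  assumes W: "linked D 1 W" and xy: "(x, y) \<in> W"
    and ends: "\<And>x y. (x, y) \<in> W \<Longrightarrow> heavy D y b"
    and ax: "{a, x} \<in> edges G" "c {a, x} \<noteq> c0"
    and new: "a \<notin> insert b A" "x \<notin> insert b A" "b \<notin> A"
    and A: "finite A" and D: "card A + 20 + 6 * r < D"
  shows "\<exists>p. rainbow_path A {c0} p \<and> p \<noteq> [] \<and> hd p = b \<and> last p = a \<and> length p = 2 * r + 5"
proof -
  let ?A = "insert b A"
  have cA: "card ?A \<le> card A + 1" using A by (simp add: card_insert_if)
  have walk: "rainbow_path ?A {c0} [x, a]"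
    using new ax edge_verts [OF ax(1)] by (auto simp: rainbow_path_def insert_commute)
  have "card ?A + 2 * card {c0} + 2 + 3 * (length [x, a] + 1 * (2 * r)) < D"
    using D cA by simp
  from linked_walk [OF W walk _ _ _ _ _ this, of b]
  have "\<exists>q. q \<noteq> [] \<and> rainbow_path ?A {c0} q \<and> length q = length [x, a] + 1 * Suc (2 * r) \<and> last q = a \<and>
    hd q \<in> Range W"
    using DomainI [OF xy] A by auto
  then obtain q where q: "q \<noteq> []" "rainbow_path ?A {c0} q" "length q = length [x, a] + 1 * Suc (2 * r)" "last q = a"
    "hd q \<in> Range W"
    by blast
  have "heavy D (hd q) b" using q(5) ends by blast
  then have "card A + 2 * card {c0} + 3 * length q < card (common_neighbours (hd q) b)"
    using D q(3) by (auto simp: heavy_def)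
  moreover have "rainbow_path A {c0} q" by (rule rainbow_path_mono [OF q(2)]) auto
  moreover have "b \<notin> set q" using q(2) by (auto simp: rainbow_path_def)
  ultimately obtain u where "rainbow_path A {c0} (b # u # q)"
    using extend_via_common_neighbour [of A "{c0}" q b] q(1) A new by auto
  then show ?thesis using q by (intro exI [of _ "b # u # q"]) auto
qed

text \<open>For odd \<open>r\<close> a path along heavy pairs also uses \<open>{x, y}\<close> or, if it is built backwards from \<open>b\<close>,
  \<open>{y, z}\<close>. These edges have different colours, so one of them avoids \<open>c0\<close>.\<close>

lemma path_from_many_triples:
  assumes T: "T \<subseteq> verts G \<times> verts G \<times> verts G" "card T > 3 * D\<^sup>2 * card (verts G)"
    and path: "\<And>x y z. (x, y, z) \<in> T \<Longrightarrow>
      {a, x} \<in> edges G \<and> {x, y} \<in> edges G \<and> {y, z} \<in> edges G \<and> {z, b} \<in> edges G \<and>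
      heavy D a y \<and> heavy D x z \<and> heavy D y b \<and> c {a, x} \<noteq> c0 \<and>
      {x, y, z} \<inter> insert a (insert b A) = {} \<and> x \<noteq> z"
    and ab: "a \<noteq> b" "a \<notin> A" "b \<notin> A" and A: "finite A" and D: "card A + 20 + 6 * r < D"
  shows "\<exists>p. rainbow_path A {c0} p \<and> p \<noteq> [] \<and> hd p = b \<and> last p = a \<and> length p = 2 * r + 5"
proof -
  let ?n = "card (verts G)"
  define ends where "ends = (\<lambda>(x, y, z). (x :: 'a, z :: 'a)) ` T"
  have finT: "finite T" using T(1) by (rule finite_subset) simp
  have ends_verts: "fst ` ends \<subseteq> verts G" "snd ` ends \<subseteq> verts G"
    using T(1) by (auto simp: ends_def)
  then have cends: "card (fst ` ends) \<le> ?n" "card (snd ` ends) \<le> ?n"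
    by (auto intro: card_mono)
  show ?thesis
  proof (cases "card ends > 2 * D * ?n")
    \<comment> \<open>The two coordinates take at most \<open>2 * card (verts G)\<close> values
      together, so pruning leaves a nonempty relation of heavy pairs with at least \<open>D\<close>
      partners on either side.\<close>
    case True
    have "D * card (fst ` ends) + D * card (snd ` ends) \<le> 2 * D * ?n"
      using cends mult_le_mono2 [of _ _ D] by (metis add_mono mult_2 mult.assoc mult.left_commute)
    then have "card ends > D * card (fst ` ends) + D * card (snd ` ends)" using True by linarith
    moreover have "finite ends" using finT by (simp add: ends_def)
    ultimately obtain W where W: "W \<subseteq> ends" "W \<noteq> {}"
      and deg: "\<And>t. t \<in> W \<Longrightarrow> D \<le> card {t' \<in> W. fst t' = fst t} \<and> D \<le> card {t' \<in> W. snd t' = snd t}"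
      using exists_subset_large_fibres [of ends D fst D snd] by blast
    have finW: "finite W" using W(1) finT by (auto simp: ends_def intro: finite_subset)
    have W_path: "{a, x} \<in> edges G" "{z, b} \<in> edges G" "heavy D x z" "c {a, x} \<noteq> c0"
      "x \<notin> insert a (insert b A)" "z \<notin> insert a (insert b A)" if "(x, z) \<in> W" for x z
      using that W(1) path unfolding ends_def by fast+
    have linked: "linked D 2 W"
      unfolding linked_def
    proof (clarsimp, intro conjI)
      fix x z assume xz: "(x, z) \<in> W"
      have "{t' \<in> W. fst t' = x} = Pair x ` (W `` {x})" by force
      then have "card {t' \<in> W. fst t' = x} \<le> card (W `` {x})"
        using finW by (metis card_image_le finite_Image)
      then show "D \<le> card (W `` {x})" using deg [OF xz] by simp
      have "{t' \<in> W. snd t' = z} = (\<lambda>x. (x, z)) ` (W\<inverse> `` {z})" by force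
      then have "card {t' \<in> W. snd t' = z} \<le> card (W\<inverse> `` {z})"
        using finW by (metis card_image_le finite_Image finite_converse)
      then show "D \<le> card (W\<inverse> `` {z})" using deg [OF xz] by simp
      show "heavy D x z" using W_path(3) [OF xz] .
    qed
    obtain x z where xz: "(x, z) \<in> W" using W(2) by auto
    then obtain y where y: "(x, y, z) \<in> T" using W(1) by (auto simp: ends_def)
    note xyz = path [OF y]
    have "c {x, y} \<noteq> c0 \<or> c {y, z} \<noteq> c0"
      using xyz colour_neq [of y x z] by (auto simp: insert_commute)
    then consider "even r" | "odd r" "c {x, y} \<noteq> c0" | "odd r" "c {y, z} \<noteq> c0"
      by blast
    then show ?thesis
    proof cases
      case 1
      show ?thesis
        by (rule path_through_heavy_pairs_even [OF linked xz W_path(2)]) (use xyz ab A D 1 in auto)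
    next
      case 2
      show ?thesis
        by (rule path_through_heavy_pairs_odd [OF linked xz W_path(2), where y = y]) (use xyz ab A D 2 in auto)
    next
      case 3
      have "\<exists>p. rainbow_path A {c0} p \<and> p \<noteq> [] \<and> hd p = a \<and> last p = b \<and> length p = 2 * r + 5"
      proof (rule path_through_heavy_pairs_odd [OF linked_converse [OF linked]])
        show "(z, x) \<in> W\<inverse>" using xz by simp
        show "{z', a} \<in> edges G" if "(x', z') \<in> W\<inverse>" for x' z'
          using W_path(1) [of z' x'] that by (simp add: insert_commute)
        show "heavy D b y" using xyz by (simp add: heavy_commute)
        show "{z, y} \<in> edges G" "c {z, y} \<noteq> c0" using xyz 3 by (simp_all add: insert_commute)
      qed (use xyz ab A D 3 in auto)
      then obtain p where "rainbow_path A {c0} p \<and> p \<noteq> [] \<and> hd p = a \<and> last p = b \<and> length p = 2 * r + 5"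
        by blast
      then show ?thesis
        by (intro exI [of _ "rev p"]) (simp add: rainbow_path_rev hd_rev last_rev)
    qed
  next
    case False
    \<comment> \<open>With few pairs \<open>(x, z)\<close>, the triples can be pruned so that each
      remaining pair has at least \<open>D\<close> middle vertices and each middle vertex at least
      \<open>D\<^sup>2\<close> pairs.\<close>
    have "D * card ends + D\<^sup>2 * card ((\<lambda>(x, y, z). y) ` T) \<le> D * (2 * D * ?n) + D\<^sup>2 * ?n"
    proof (intro add_mono mult_le_mono2)
      show "card ((\<lambda>(x, y, z). y) ` T) \<le> ?n" using T(1) by (intro card_mono) auto
    qed (use False in simp)
    also have "\<dots> = 3 * D\<^sup>2 * ?n" by (simp add: power2_eq_square)
    finally have "card T > D * card ((\<lambda>(x, y, z). (x, z)) ` T) + D\<^sup>2 * card ((\<lambda>(x, y, z). y) ` T)"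
      using T(2) by (simp add: ends_def)
    from exists_subset_large_fibres [OF finT this]
    obtain T' where T': "T' \<subseteq> T" "T' \<noteq> {}" and deg: "\<And>t. t \<in> T' \<Longrightarrow>
        D \<le> card {t' \<in> T'. (\<lambda>(x, y, z). (x, z)) t' = (\<lambda>(x, y, z). (x, z)) t} \<and>
        D\<^sup>2 \<le> card {t' \<in> T'. (\<lambda>(x, y, z). y) t' = (\<lambda>(x, y, z). y) t}"
      by blast
    have finT': "finite T'" using T'(1) finT finite_subset by blast
    \<comment> \<open>The edges are directed towards the middle vertex. The at least
      \<open>D\<^sup>2\<close> pairs over \<open>y\<close> embed in the square of its
      in-neighbourhood, which therefore has at least \<open>D\<close> elements.\<close>
    define W where "W = (\<Union>(x, y, z)\<in>T'. {(x, y), (z, y)})"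
    have finW: "finite W" using finT' by (auto simp: W_def)
    have out: "D \<le> card (W `` {x})" "D \<le> card (W `` {z})" and into: "D \<le> card (W\<inverse> `` {y})"
      if t: "(x, y, z) \<in> T'" for x y z
    proof -
      let ?S = "{t' \<in> T'. (\<lambda>(x, y, z). (x, z)) t' = (x, z)}"
      have S: "?S = (\<lambda>y. (x, y, z)) ` {y. (x, y, z) \<in> T'}" by auto
      have fin: "finite {y. (x, y, z) \<in> T'}"
        by (rule finite_subset [of _ "(\<lambda>(x, y, z). y) ` T'"]) (use finT' in \<open>auto intro: rev_image_eqI\<close>)
      have "card ?S \<le> card {y. (x, y, z) \<in> T'}"
        unfolding S by (rule card_image_le [OF fin])
      then have "D \<le> card {y. (x, y, z) \<in> T'}" using deg [OF t] by simp
      also have "card {y. (x, y, z) \<in> T'} \<le> card (W `` {x})"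
        using finW by (intro card_mono finite_Image) (auto simp: W_def)
      finally show "D \<le> card (W `` {x})" .
      have "D \<le> card {y. (x, y, z) \<in> T'}" by fact
      also have "card {y. (x, y, z) \<in> T'} \<le> card (W `` {z})"
        using finW by (intro card_mono finite_Image) (auto simp: W_def)
      finally show "D \<le> card (W `` {z})" .
      have "{t' \<in> T'. (\<lambda>(x, y, z). y) t' = y} \<subseteq> (\<lambda>(x, z). (x, y, z)) ` (W\<inverse> `` {y} \<times> W\<inverse> `` {y})"
      proof
        fix t' assume "t' \<in> {t' \<in> T'. (\<lambda>(x, y, z). y) t' = y}"
        then obtain x' z' where t': "t' = (x', y, z')" "(x', y, z') \<in> T'"
          by (cases t') auto
        then have "(x', y) \<in> W" "(z', y) \<in> W" unfolding W_def by blast+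
        then have "(x', z') \<in> W\<inverse> `` {y} \<times> W\<inverse> `` {y}" by simp
        then show "t' \<in> (\<lambda>(x, z). (x, y, z)) ` (W\<inverse> `` {y} \<times> W\<inverse> `` {y})"
          unfolding t'(1) by (rule rev_image_eqI) simp
      qed
      then have "card {t' \<in> T'. (\<lambda>(x, y, z). y) t' = y} \<le> card (W\<inverse> `` {y} \<times> W\<inverse> `` {y})"
        using finW by (intro surj_card_le) auto
      then have "D\<^sup>2 \<le> (card (W\<inverse> `` {y}))\<^sup>2"
        using deg [OF t] by (simp add: card_cartesian_product power2_eq_square)
      then show "D \<le> card (W\<inverse> `` {y})" by (simp add: power2_nat_le_eq_le)
    qed
    have linked: "linked D 1 W"
      unfolding linked_def
    proof (intro ballI, clarify, intro conjI)
      fix x y assume "(x, y) \<in> W"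
      then obtain x' z' where t: "(x', y, z') \<in> T'" "x = x' \<or> x = z'" by (auto simp: W_def)
      show "D \<le> card (W `` {x})" using out [OF t(1)] t(2) by auto
      show "D \<le> card (W\<inverse> `` {y})" using into [OF t(1)] .
      have "{x, y} \<in> edges G" using path [of x' y z'] t T'(1) by (auto simp: insert_commute)
      then show "1 = 1 \<and> {x, y} \<in> edges G \<or> 1 = 2 \<and> heavy D x y" by simp
    qed
    obtain x y z where t: "(x, y, z) \<in> T'" using T'(2) by auto
    then have xy: "(x, y) \<in> W" by (auto simp: W_def)
    have xyz: "(x, y, z) \<in> T" using t T'(1) by blast
    show ?thesis
    proof (rule path_through_edges [OF linked xy])
      show "heavy D y b" if xy': "(x, y) \<in> W" for x y
      proof -
        obtain x' z' where "(x', y, z') \<in> T'" using xy' by (auto simp: W_def)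
        then have "(x', y, z') \<in> T" using T'(1) by blast
        from path [OF this] show ?thesis by simp
      qed
    qed (use path [OF xyz] ab A D in auto)
  qed
qed

section \<open>Rainbow cycles and labelled cycles\<close>

text \<open>The path avoids the colour \<open>c0\<close>, which is that of the closing edge, so all
  \<open>m\<close> edges of the cycle have different colours.\<close>

lemma rainbow_cycle_from_path:
  assumes p: "rainbow_path A {c0} p" and len: "length p = m" "m \<ge> 3"
    and closing: "{last p, hd p} \<in> edges G" "c {last p, hd p} = c0"
  shows "\<exists>S\<in>copies (cycle_graph m) G. rainbow c S"
proof -
  define e where "e i = {p ! i, p ! (Suc i mod m)}" for i
  have "p \<noteq> []" using len by auto
  have step: "e i = walk_edges p ! i" if "i < m - 1" for i
    using that len by (simp add: e_def walk_edges_conv)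
  have last: "e (m - 1) = {last p, hd p}"
    using len \<open>p \<noteq> []\<close> by (simp add: e_def last_conv_nth hd_conv_nth)
  have "[0..<m] = [0..<m - 1] @ [m - 1]"
    using len(2) by (metis Suc_diff_1 less_le_trans upt_Suc_append zero_le zero_less_numeral)
  moreover have "map e [0..<m - 1] = walk_edges p"
    by (rule nth_equalityI) (use len step in auto)
  ultimately have e: "map e [0..<m] = walk_edges p @ [{last p, hd p}]"
    using last by simp
  have edges: "e i \<in> edges G" if "i < m" for i
  proof -
    have "e i \<in> set (map e [0..<m])" using that by simp
    then show ?thesis unfolding e using p closing(1) by (auto simp: rainbow_path_def)
  qed
  have "map (c \<circ> e) [0..<m] = map c (walk_edges p) @ [c0]"
    using arg_cong [OF e, of "map c"] closing(2) by simp
  then have "distinct (map (c \<circ> e) [0..<m])"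
    using p by (auto simp: rainbow_path_def)
  then have "inj_on (c \<circ> e) {..<m}" by (simp add: distinct_map atLeast0LessThan)
  then have inj: "inj_on c (e ` {..<m})" by (rule inj_on_imageI)
  let ?S = "(set p, e ` {..<m})"
  have "set p \<subseteq> verts G"
  proof
    fix v assume "v \<in> set p"
    then obtain i where "i < m" "v = p ! i" using len by (auto simp: in_set_conv_nth)
    then show "v \<in> verts G" using edges [of i] edge_verts by (auto simp: e_def)
  qed
  moreover have "e ` {..<m} \<subseteq> edges G" using edges by auto
  moreover have "e i \<subseteq> set p" if "i < m" for i
    using that len by (auto simp: e_def intro!: nth_mem)
  moreover have "card (e i) = 2" if "i < m" for i
    using edges [OF that] simple by (simp add: simple_graph_def)
  ultimately have "subgraph ?S G"
    by (auto simp: subgraph_def simple_graph_def)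
  moreover have "bij_betw ((!) p) {..<m} (set p)"
    using p len by (intro bij_betw_nth) (auto simp: rainbow_path_def)
  then have "graph_iso (cycle_graph m) ?S"
    unfolding graph_iso_def cycle_graph_def by (auto simp: image_image e_def)
  ultimately have "?S \<in> copies (cycle_graph m) G" by (simp add: copies_def)
  then show ?thesis using inj unfolding rainbow_def by (intro bexI [of _ ?S]) simp
qed

definition cycle_maps :: "nat \<Rightarrow> (nat \<Rightarrow> 'a) set" where
  "cycle_maps m = {f \<in> {..<m} \<rightarrow>\<^sub>E verts G.
     inj_on f {..<m} \<and> (\<forall>i<m. {f i, f (Suc i mod m)} \<in> edges G)}"

lemma finite_cycle_maps [simp]: "finite (cycle_maps m)"
  by (rule finite_subset [of _ "{..<m} \<rightarrow>\<^sub>E verts G"]) (auto simp: cycle_maps_def intro!: finite_PiE)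

text \<open>Every copy is the image of some labelled cycle; counting it several times is harmless
  for an upper bound.\<close>

lemma card_copies_le_cycle_maps:
  assumes "m > 0"
  shows "card (copies (cycle_graph m) G) \<le> card (cycle_maps m)"
proof (rule surj_card_le [OF finite_cycle_maps], rule subsetI)
  fix S assume S: "S \<in> copies (cycle_graph m) G"
  then obtain f where f: "bij_betw f {..<m} (verts S)"
    and edges: "edges S = (\<lambda>i. {f i, f (Suc i mod m)}) ` {..<m}"
    by (auto simp: copies_def graph_iso_def cycle_graph_def image_image)
  let ?f = "restrict f {..<m}"
  have f': "?f i = f i" "?f (Suc i mod m) = f (Suc i mod m)" if "i < m" for i
    using that assms by auto
  have S': "verts S \<subseteq> verts G" "edges S \<subseteq> edges G" using S by (auto simp: copies_def subgraph_def)
  have "?f \<in> cycle_maps m"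
    unfolding cycle_maps_def mem_Collect_eq
  proof (intro conjI allI impI)
    show "?f \<in> {..<m} \<rightarrow>\<^sub>E verts G" using f S' by (auto simp: bij_betw_def)
    show "inj_on ?f {..<m}" using f by (simp add: bij_betw_def inj_on_def)
    show "{?f i, ?f (Suc i mod m)} \<in> edges G" if "i < m" for i
      using that S'(2) unfolding edges f' [OF that] by auto
  qed
  moreover have "S = (?f ` {..<m}, (\<lambda>i. {?f i, ?f (Suc i mod m)}) ` {..<m})"
  proof (rule prod_eqI)
    show "verts S = verts (?f ` {..<m}, (\<lambda>i. {?f i, ?f (Suc i mod m)}) ` {..<m})"
      using f by (simp add: bij_betw_def)
    have "(\<lambda>i. {?f i, ?f (Suc i mod m)}) ` {..<m} = edges S"
      unfolding edges by (rule image_cong) (simp_all add: f')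
    then show "edges S = edges (?f ` {..<m}, (\<lambda>i. {?f i, ?f (Suc i mod m)}) ` {..<m})" by simp
  qed
  ultimately show "S \<in> (\<lambda>f. (f ` {..<m}, (\<lambda>i. {f i, f (Suc i mod m)}) ` {..<m})) ` cycle_maps m"
    by blast
qed

text \<open>\<open>J\<close> is the set of exempt positions: for \<open>i\<close> in
  \<open>J\<close> the pair of vertices at \<open>i\<close> and \<open>i + 2\<close> may be heavy or
  not. With \<open>J\<close> the last two positions, exactly the pairs that wrap around are
  exempt.\<close>

definition heavy_cycle_maps :: "nat \<Rightarrow> nat \<Rightarrow> nat set \<Rightarrow> (nat \<Rightarrow> 'a) set" where
  "heavy_cycle_maps D m J =
     {f \<in> cycle_maps m. \<forall>i<m. i \<notin> J \<longrightarrow> heavy D (f i) (f ((i + 2) mod m))}"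

text \<open>Induction on \<open>j\<close>, starting at \<open>j = 2\<close> with the path obtained
  from the triples for \<open>r = k - l\<close>. Each further step passes from
  \<open>f (2 * j)\<close> to \<open>f (2 * j + 2)\<close> by a common neighbour. For
  \<open>j = l\<close> the path has \<open>2 * k\<close> edges and avoids the colour of the closing
  edge.\<close>

lemma extend_path_along_cycle:
  assumes l: "2 \<le> l" "l \<le> k" and D: "10 * k + 30 \<le> D"
    and f: "f \<in> heavy_cycle_maps D (2 * l + 1) {2 * l - 1, 2 * l}"
    and T: "card T > 3 * D\<^sup>2 * card (verts G)"
    and fibre: "\<And>x y z. (x, y, z) \<in> T \<Longrightarrow>
      f(1 := x, 2 := y, 3 := z) \<in> heavy_cycle_maps D (2 * l + 1) {2 * l - 1, 2 * l}"
    and j: "2 \<le> j" "j \<le> l"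
  shows "\<exists>p. rainbow_path (f ` {2 * j<..<2 * l + 1}) {c {f (2 * l), f 0}} p \<and> p \<noteq> [] \<and>
    hd p = f (2 * j) \<and> last p = f 0 \<and> length p = 2 * j + 2 * (k - l) + 1"
  using j
proof (induction j rule: nat_induct_at_least)
  case base
  let ?A = "f ` {4<..<2 * l + 1}"
  have f_in: "f i \<in> verts G" if "i < 2 * l + 1" for i
    using f that by (auto simp: heavy_cycle_maps_def cycle_maps_def)
  have inj: "f i \<noteq> f i'" if "i < 2 * l + 1" "i' < 2 * l + 1" "i \<noteq> i'" for i i'
    using f that by (auto simp: heavy_cycle_maps_def cycle_maps_def inj_on_def)
  have "\<exists>p. rainbow_path ?A {c {f (2 * l), f 0}} p \<and> p \<noteq> [] \<and> hd p = f 4 \<and> last p = f 0 \<and>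
      length p = 2 * (k - l) + 5"
  proof (rule path_from_many_triples [OF _ T])
    have triple: "{f 0, x} \<in> edges G \<and> {x, y} \<in> edges G \<and> {y, z} \<in> edges G \<and> {z, f 4} \<in> edges G \<and>
      heavy D (f 0) y \<and> heavy D x z \<and> heavy D y (f 4) \<and> c {f 0, x} \<noteq> c {f (2 * l), f 0} \<and>
      {x, y, z} \<inter> insert (f 0) (insert (f 4) ?A) = {} \<and> x \<noteq> z \<and>
      x \<in> verts G \<and> y \<in> verts G \<and> z \<in> verts G"
      if "(x, y, z) \<in> T" for x y z
    proof -
      define g where "g = f(1 := x, 2 := y, 3 := z)"
      have g: "g \<in> heavy_cycle_maps D (2 * l + 1) {2 * l - 1, 2 * l}"
        using fibre [OF that] by (simp add: g_def)
      have g_simps: "g 1 = x" "g 2 = y" "g 3 = z" "g 0 = f 0" "\<And>i. i > 3 \<Longrightarrow> g i = f i"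
        by (auto simp: g_def)
      have g_in: "g i \<in> verts G" if "i < 2 * l + 1" for i
        using g that by (auto simp: heavy_cycle_maps_def cycle_maps_def)
      have g_edge: "{g i, g (Suc i)} \<in> edges G" if "Suc i < 2 * l + 1" for i
      proof -
        have "{g i, g (Suc i mod (2 * l + 1))} \<in> edges G"
          using g that unfolding heavy_cycle_maps_def cycle_maps_def mem_Collect_eq
          using Suc_lessD by blast
        then show ?thesis using that by simp
      qed
      have g_heavy: "heavy D (g i) (g (i + 2))" if "i + 2 < 2 * l + 1" for i
      proof -
        have "i < 2 * l + 1" "i \<notin> {2 * l - 1, 2 * l}" using that by auto
        then have "heavy D (g i) (g ((i + 2) mod (2 * l + 1)))"
          using g unfolding heavy_cycle_maps_def mem_Collect_eq by blast
        then show ?thesis using that by simp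
      qed
      have g_inj: "g i \<noteq> g i'" if "i < 2 * l + 1" "i' < 2 * l + 1" "i \<noteq> i'" for i i'
        using g that by (auto simp: heavy_cycle_maps_def cycle_maps_def inj_on_def)
      have "{g (2 * l), g (Suc (2 * l) mod (2 * l + 1))} \<in> edges G"
        using g unfolding heavy_cycle_maps_def cycle_maps_def mem_Collect_eq
        using less_add_one by blast
      then have "{f 0, f (2 * l)} \<in> edges G" using l g_simps by (simp add: insert_commute)
      moreover have "x \<noteq> f (2 * l)" using g_inj [of 1 "2 * l"] l g_simps by simp
      \<comment> \<open>Both edges contain \<open>f 0\<close>, and their other ends differ.\<close>
      ultimately have "c {f 0, x} \<noteq> c {f (2 * l), f 0}"
        using colour_neq [of "f 0" x "f (2 * l)"] g_edge [of 0] l g_simps by (simp add: insert_commute)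
      moreover have "f i \<notin> {x, y, z}" if "i \<in> {0, 4} \<union> {4<..<2 * l + 1}" for i
        using g_inj [of 1 i] g_inj [of 2 i] g_inj [of 3 i] g_simps that l by auto
      then have "{x, y, z} \<inter> f ` ({0, 4} \<union> {4<..<2 * l + 1}) = {}" by blast
      then have "{x, y, z} \<inter> insert (f 0) (insert (f 4) ?A) = {}"
        by (simp only: image_Un image_insert image_empty Un_insert_left Un_empty_left)
      ultimately show ?thesis
        using g_in [of 1] g_in [of 2] g_in [of 3] g_edge [of 0] g_edge [of 1] g_edge [of 2] g_edge [of 3]
          g_heavy [of 0] g_heavy [of 1] g_heavy [of 2] g_inj [of 1 3] g_simps l
        by (simp add: eval_nat_numeral)
    qed
    show "T \<subseteq> verts G \<times> verts G \<times> verts G" using triple by auto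
    show "{f 0, x} \<in> edges G \<and> {x, y} \<in> edges G \<and> {y, z} \<in> edges G \<and> {z, f 4} \<in> edges G \<and>
      heavy D (f 0) y \<and> heavy D x z \<and> heavy D y (f 4) \<and> c {f 0, x} \<noteq> c {f (2 * l), f 0} \<and>
      {x, y, z} \<inter> insert (f 0) (insert (f 4) ?A) = {} \<and> x \<noteq> z"
      if "(x, y, z) \<in> T" for x y z using triple [OF that] by blast
    show "f 0 \<noteq> f 4" using inj l by simp
    show "f 0 \<notin> ?A" "f 4 \<notin> ?A" using inj l by fastforce+
    have "card ?A \<le> card {4<..<2 * l + 1}" by (rule card_image_le) simp
    then show "card ?A + 20 + 6 * (k - l) < D" using D l by simp
  qed simp
  then show ?case by (simp add: add_ac)
next
  case (Suc j)
  let ?A = "f ` {2 * j<..<2 * l + 1}" and ?A' = "f ` {2 * Suc j<..<2 * l + 1}"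
  obtain p where p: "rainbow_path ?A {c {f (2 * l), f 0}} p" "p \<noteq> []" "hd p = f (2 * j)"
    "last p = f 0" "length p = 2 * j + 2 * (k - l) + 1"
    using Suc by auto
  \<comment> \<open>The positions \<open>2 * j + 1\<close> and \<open>2 * j + 2\<close> are
    released: the second is visited next, the first is bypassed or happens to be the common
    neighbour.\<close>
  have "rainbow_path ?A' {c {f (2 * l), f 0}} p" by (rule rainbow_path_mono [OF p(1)]) auto
  moreover have "f (2 * Suc j) \<notin> ?A'"
  proof
    assume "f (2 * Suc j) \<in> ?A'"
    then obtain i where "2 * Suc j < i" "i < 2 * l + 1" "f (2 * Suc j) = f i" by auto
    moreover have "inj_on f {..<2 * l + 1}"
      using f by (simp add: heavy_cycle_maps_def cycle_maps_def)
    ultimately show False using inj_onD [of f "{..<2 * l + 1}" "2 * Suc j" i] by simp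
  qed
  moreover have "f (2 * Suc j) \<in> ?A" using Suc.prems by auto
  then have "f (2 * Suc j) \<notin> set p" using p(1) by (auto simp: rainbow_path_def)
  moreover have "heavy D (f (2 * j)) (f ((2 * j + 2) mod (2 * l + 1)))"
  proof -
    have "2 * j < 2 * l + 1" "2 * j \<notin> {2 * l - 1, 2 * l}" using Suc.prems by auto
    then show ?thesis using f unfolding heavy_cycle_maps_def mem_Collect_eq by blast
  qed
  then have "D \<le> card (common_neighbours (hd p) (f (2 * Suc j)))"
    using p(3) Suc.prems by (simp add: heavy_def)
  moreover have "card ?A' \<le> card {2 * Suc j<..<2 * l + 1}" by (rule card_image_le) simp
  \<comment> \<open>The path has fewer than \<open>2 * k + 1\<close> vertices and \<open>?A'\<close>
    fewer than \<open>2 * k\<close>, so \<open>10 * k + 30\<close> is a generous bound.\<close>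
  then have "card ?A' + 2 * card {c {f (2 * l), f 0}} + 3 * length p < 10 * k + 30"
    using l p(5) Suc.prems by simp
  ultimately obtain u where "rainbow_path ?A' {c {f (2 * l), f 0}} (f (2 * Suc j) # u # p)"
    using extend_via_common_neighbour [of ?A' "{c {f (2 * l), f 0}}" p "f (2 * Suc j)"] p(2) D by force
  then show ?case using p by (intro exI [of _ "f (2 * Suc j) # u # p"]) simp
qed

end

section \<open>Counting labelled cycles by rotation and restriction\<close>

lemma bij_betw_shift_mod:
  fixes m s :: nat
  assumes "m > 0"
  shows "bij_betw (\<lambda>i. (i + s) mod m) {..<m} {..<m}"
proof -
  have eq: "i = j" if "i \<le> j" "j < m" "(j + s) mod m = (i + s) mod m" for i j
  proof -
    have "m dvd (j + s) - (i + s)" using that mod_eq_dvd_iff_nat [of "i + s" "j + s" m] by simp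
    then have "m dvd j - i" by simp
    then show ?thesis using that nat_dvd_not_less [of "j - i" m] by linarith
  qed
  have "inj_on (\<lambda>i. (i + s) mod m) {..<m}"
  proof (rule inj_onI)
    fix i j assume "i \<in> {..<m}" "j \<in> {..<m}" "(i + s) mod m = (j + s) mod m"
    then show "i = j" using eq [of i j] eq [of j i] by (cases "i \<le> j") auto
  qed
  then show ?thesis using assms by (intro bij_betw_imageI endo_inj_surj) auto
qed

context coloured_graph
begin

lemma card_restriction_le:
  fixes m :: nat
  assumes "F \<subseteq> {..<m} \<rightarrow>\<^sub>E verts G" "X \<subseteq> {..<m}"
  shows "card ((\<lambda>f. restrict f X) ` F) \<le> card (verts G) ^ card X"
proof -
  have finX: "finite X" by (rule finite_subset [OF assms(2)]) simp
  have "(\<lambda>f. restrict f X) ` F \<subseteq> X \<rightarrow>\<^sub>E verts G"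
  proof (rule image_subsetI)
    fix f assume "f \<in> F"
    then have "f i \<in> verts G" if "i \<in> X" for i using assms that by (auto simp: PiE_iff)
    then show "restrict f X \<in> X \<rightarrow>\<^sub>E verts G" by simp
  qed
  then have "card ((\<lambda>f. restrict f X) ` F) \<le> card (X \<rightarrow>\<^sub>E verts G)"
    using finX by (intro card_mono finite_PiE) auto
  then show ?thesis using finX by (simp add: card_funcsetE)
qed

lemma PiE_eqI_restrict:
  assumes "f \<in> {..<m} \<rightarrow>\<^sub>E V" "g \<in> {..<m} \<rightarrow>\<^sub>E V" "restrict f X = restrict g X"
    and "\<And>i. i < m \<Longrightarrow> i \<notin> X \<Longrightarrow> f i = g i"
  shows "f = g"
proof (rule PiE_ext [OF assms(1,2)])
  show "f i = g i" if "i \<in> {..<m}" for i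
    using that assms(3,4) by (metis lessThan_iff restrict_apply')
qed

text \<open>All positions except 1, 2 and 3 are fixed in at most
  \<open>card (verts G) ^ (2 * l - 2)\<close> ways. More than
  \<open>3 * D\<^sup>2 * card (verts G)\<close> completions of one choice would yield a rainbow
  cycle of length \<open>2 * k + 1\<close>.\<close>

lemma card_heavy_cycle_maps_final:
  assumes l: "2 \<le> l" "l \<le> k" and D: "10 * k + 30 \<le> D"
    and free: "\<not> (\<exists>S\<in>copies (cycle_graph (2 * k + 1)) G. rainbow c S)"
  shows "card (heavy_cycle_maps D (2 * l + 1) {2 * l - 1, 2 * l})
    \<le> 3 * D\<^sup>2 * card (verts G) ^ (2 * l - 1)"
proof -
  let ?F = "heavy_cycle_maps D (2 * l + 1) {2 * l - 1, 2 * l}" and ?n = "card (verts G)"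
  let ?X = "{..<2 * l + 1} - {1, 2, 3}"
  have F: "?F \<subseteq> {..<2 * l + 1} \<rightarrow>\<^sub>E verts G"
    by (auto simp: heavy_cycle_maps_def cycle_maps_def)
  have finF: "finite ?F"
    by (rule finite_subset [OF _ finite_cycle_maps]) (auto simp: heavy_cycle_maps_def)
  have fibre: "card {f' \<in> ?F. restrict f' ?X = restrict f ?X} \<le> 3 * D\<^sup>2 * ?n" if f: "f \<in> ?F" for f
  proof (rule ccontr)
    let ?fib = "{f' \<in> ?F. restrict f' ?X = restrict f ?X}"
    let ?T = "(\<lambda>f'. (f' 1, f' 2, f' 3)) ` ?fib"
    assume large: "\<not> ?thesis"
    have "inj_on (\<lambda>f'. (f' 1, f' 2, f' 3)) ?fib"
    proof (rule inj_onI)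
      fix g h assume gh: "g \<in> ?fib" "h \<in> ?fib" "(g 1, g 2, g 3) = (h 1, h 2, h 3)"
      show "g = h"
      proof (rule PiE_eqI_restrict)
        show "g \<in> {..<2 * l + 1} \<rightarrow>\<^sub>E verts G" "h \<in> {..<2 * l + 1} \<rightarrow>\<^sub>E verts G"
          using gh F by auto
        show "restrict g ?X = restrict h ?X" using gh by simp
        show "g i = h i" if "i < 2 * l + 1" "i \<notin> ?X" for i using gh(3) that by auto
      qed
    qed
    then have "card ?T = card ?fib" by (rule card_image)
    then have T: "card ?T > 3 * D\<^sup>2 * ?n" using large by linarith
    have "f(1 := x, 2 := y, 3 := z) \<in> ?F" if xyz: "(x, y, z) \<in> ?T" for x y z
    proof -
      obtain g where g: "g \<in> ?F" "restrict g ?X = restrict f ?X" "g 1 = x" "g 2 = y" "g 3 = z"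
        using xyz by auto
      have "g i = (f(1 := x, 2 := y, 3 := z)) i" for i
      proof (cases "i \<in> ?X")
        case True
        then show ?thesis using fun_cong [OF g(2), of i] by auto
      next
        case False
        then consider "i \<in> {1, 2, 3}" | "\<not> i < 2 * l + 1" by auto
        then show ?thesis
        proof cases
          \<comment> \<open>Outside the index range both extensional functions are
            \<open>undefined\<close>, and \<open>l \<ge> 2\<close> keeps the updated positions 1, 2,
            3 inside it.\<close>
          case 2
          then have "g i = undefined" "f i = undefined"
            using subsetD [OF F g(1)] subsetD [OF F f] by (auto simp: PiE_iff extensional_def)
          then show ?thesis using 2 l by simp
        qed (use g in auto)
      qed
      then have "g = f(1 := x, 2 := y, 3 := z)" by blast
      then show ?thesis using g(1) by simp
    qed
    from extend_path_along_cycle [OF l D f T this l(1) order_refl]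
    obtain p where p: "rainbow_path {} {c {f (2 * l), f 0}} p" "p \<noteq> []" "hd p = f (2 * l)"
      "last p = f 0" "length p = 2 * l + 2 * (k - l) + 1"
      by (auto intro: rainbow_path_mono)
    have "{f (2 * l), f (Suc (2 * l) mod (2 * l + 1))} \<in> edges G"
      using f unfolding heavy_cycle_maps_def cycle_maps_def mem_Collect_eq
      using less_add_one by blast
    then have "{last p, hd p} \<in> edges G" using p by (simp add: insert_commute)
    moreover have "length p = 2 * k + 1" using p(5) l by simp
    moreover have "2 * k + 1 \<ge> 3" using l by simp
    moreover have "c {last p, hd p} = c {f (2 * l), f 0}" using p by (simp add: insert_commute)
    ultimately show False using rainbow_cycle_from_path [OF p(1)] free by blast
  qed
  have "card ?F \<le> card ((\<lambda>f. restrict f ?X) ` ?F) * (3 * D\<^sup>2 * ?n)"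
    by (rule card_le_fibres [OF finF fibre])
  also have "\<dots> \<le> ?n ^ card ?X * (3 * D\<^sup>2 * ?n)"
    by (intro mult_le_mono1 card_restriction_le [OF F]) auto
  also have "card ?X = 2 * l - 2" using l by (subst card_Diff_subset) auto
  also have "?n ^ (2 * l - 2) * (3 * D\<^sup>2 * ?n) = 3 * D\<^sup>2 * ?n ^ Suc (2 * l - 2)" by simp
  also have "Suc (2 * l - 2) = 2 * l - 1" using l by simp
  finally show ?thesis .
qed

text \<open>Rotating the labels by \<open>s + 2\<close> is injective and carries
  \<open>m - 2\<close> and \<open>m - 1\<close> to \<open>s\<close> and its successor, so the exempt
  positions become the last two.\<close>

lemma card_heavy_cycle_maps_rotate:
  assumes m: "m > 2" and s: "s < m"
  shows "card (heavy_cycle_maps D m {s, Suc s mod m}) \<le> card (heavy_cycle_maps D m {m - 2, m - 1})"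
proof -
  define \<sigma> where "\<sigma> i = (i + (s + 2)) mod m" for i
  define \<rho> where "\<rho> f = (\<lambda>i\<in>{..<m}. f (\<sigma> i))" for f :: "nat \<Rightarrow> 'a"
  have \<sigma>: "bij_betw \<sigma> {..<m} {..<m}" unfolding \<sigma>_def using bij_betw_shift_mod [of m "s + 2"] m by simp
  have \<sigma>_lt: "\<sigma> i < m" for i using m by (simp add: \<sigma>_def)
  have \<sigma>_Suc: "\<sigma> (Suc i mod m) = Suc (\<sigma> i) mod m" "\<sigma> ((i + 2) mod m) = (\<sigma> i + 2) mod m" for i
  proof -
    have shift: "\<sigma> (j mod m) = \<sigma> j" "(\<sigma> j + t) mod m = \<sigma> (j + t)" for j t
      unfolding \<sigma>_def mod_add_left_eq by (simp_all only: add_ac)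
    show "\<sigma> (Suc i mod m) = Suc (\<sigma> i) mod m" "\<sigma> ((i + 2) mod m) = (\<sigma> i + 2) mod m"
      using shift(1) [of "Suc i"] shift(1) [of "i + 2"] shift(2) [of i 1] shift(2) [of i 2] by simp_all
  qed
  have "inj_on \<rho> (heavy_cycle_maps D m {s, Suc s mod m})"
  proof (rule inj_onI)
    fix f g assume fg: "f \<in> heavy_cycle_maps D m {s, Suc s mod m}" "g \<in> heavy_cycle_maps D m {s, Suc s mod m}"
      "\<rho> f = \<rho> g"
    show "f = g"
    proof (rule PiE_ext)
      show "f \<in> {..<m} \<rightarrow>\<^sub>E verts G" "g \<in> {..<m} \<rightarrow>\<^sub>E verts G"
        using fg by (simp_all add: heavy_cycle_maps_def cycle_maps_def)
      fix i assume "i \<in> {..<m}"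
      then obtain j where "j < m" "i = \<sigma> j" using \<sigma> by (auto simp: bij_betw_def)
      then show "f i = g i" using fun_cong [OF fg(3), of j] by (simp add: \<rho>_def)
    qed
  qed
  moreover have "\<rho> ` heavy_cycle_maps D m {s, Suc s mod m} \<subseteq> heavy_cycle_maps D m {m - 2, m - 1}"
  proof (rule image_subsetI)
    fix f assume f: "f \<in> heavy_cycle_maps D m {s, Suc s mod m}"
    have \<rho>_eq: "\<rho> f i = f (\<sigma> i)" if "i < m" for i using that by (simp add: \<rho>_def)
    have "\<rho> f \<in> {..<m} \<rightarrow>\<^sub>E verts G"
      using f \<sigma>_lt by (auto simp: \<rho>_def heavy_cycle_maps_def cycle_maps_def)
    moreover have "inj_on (f \<circ> \<sigma>) {..<m}"
      using f \<sigma> by (intro comp_inj_on) (auto simp: bij_betw_def heavy_cycle_maps_def cycle_maps_def)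
    then have "inj_on (\<rho> f) {..<m}" by (simp add: \<rho>_def inj_on_def)
    moreover have "{\<rho> f i, \<rho> f (Suc i mod m)} \<in> edges G" if "i < m" for i
      using f that m \<sigma>_lt [of i] by (simp add: \<rho>_eq \<sigma>_Suc heavy_cycle_maps_def cycle_maps_def)
    moreover have "heavy D (\<rho> f i) (\<rho> f ((i + 2) mod m))" if "i < m" "i \<notin> {m - 2, m - 1}" for i
    proof -
      have "m - 2 + (s + 2) = m + s" "m - 1 + (s + 2) = m + Suc s" using m by simp_all
      then have "\<sigma> (m - 2) = s" "\<sigma> (m - 1) = Suc s mod m"
        using s unfolding \<sigma>_def by (simp_all only: mod_add_self1 mod_less)
      moreover have "\<sigma> i \<noteq> \<sigma> (m - 2)" "\<sigma> i \<noteq> \<sigma> (m - 1)"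
        using \<sigma> that m by (auto simp: bij_betw_def inj_on_def)
      ultimately have "heavy D (f (\<sigma> i)) (f ((\<sigma> i + 2) mod m))"
        using f \<sigma>_lt [of i] unfolding heavy_cycle_maps_def mem_Collect_eq by auto
      moreover have "(i + 2) mod m < m" using m by simp
      ultimately show ?thesis by (simp only: \<rho>_eq [OF that(1)] \<rho>_eq [of "(i + 2) mod m"] \<sigma>_Suc)
    qed
    ultimately show "\<rho> f \<in> heavy_cycle_maps D m {m - 2, m - 1}"
      by (simp add: heavy_cycle_maps_def cycle_maps_def)
  qed
  moreover have "finite (heavy_cycle_maps D m {m - 2, m - 1})"
    by (rule finite_subset [OF _ finite_cycle_maps]) (auto simp: heavy_cycle_maps_def)
  ultimately show ?thesis by (rule card_inj_on_le)
qed

definition two_light_maps :: "nat \<Rightarrow> nat \<Rightarrow> nat \<Rightarrow> nat \<Rightarrow> (nat \<Rightarrow> 'a) set" where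
  "two_light_maps D m i j = {f \<in> cycle_maps m.
     \<not> heavy D (f i) (f ((i + 2) mod m)) \<and> \<not> heavy D (f j) (f ((j + 2) mod m))}"

text \<open>The vertex following position \<open>i\<close> is a common neighbour of a light pair,
  and likewise for \<open>j\<close>. As \<open>i\<close> and \<open>j\<close> are not cyclically
  adjacent, the four ends of these pairs stay among the fixed positions, so fewer than
  \<open>D\<close> choices remain for each of the two vertices.\<close>

lemma card_two_light_maps:
  assumes m: "m > 2" and ij: "i < m" "j < m" "i \<noteq> j" "j \<noteq> Suc i mod m" "i \<noteq> Suc j mod m"
  shows "card (two_light_maps D m i j) \<le> D\<^sup>2 * card (verts G) ^ (m - 2)"
proof -
  let ?F = "two_light_maps D m i j" and ?n = "card (verts G)"
  let ?i = "Suc i mod m" and ?j = "Suc j mod m"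
  let ?X = "{..<m} - {?i, ?j}"
  have F: "?F \<subseteq> {..<m} \<rightarrow>\<^sub>E verts G"
    by (auto simp: two_light_maps_def cycle_maps_def)
  have finF: "finite ?F"
    by (rule finite_subset [OF _ finite_cycle_maps]) (auto simp: two_light_maps_def)
  have Suc_mod: "Suc t mod m = (if Suc t = m then 0 else Suc t)"
    "(t + 2) mod m = (if t + 2 < m then t + 2 else t + 2 - m)" if "t < m" for t
    using that m by (auto simp: mod_if)
  have ij_neq: "?i \<noteq> ?j" using Suc_mod(1) ij by (auto split: if_splits)
  have ends: "i \<in> ?X" "(i + 2) mod m \<in> ?X" "j \<in> ?X" "(j + 2) mod m \<in> ?X"
    using Suc_mod ij m by (auto split: if_splits)
  have fibre: "card {f' \<in> ?F. restrict f' ?X = restrict f ?X} \<le> D\<^sup>2" if f: "f \<in> ?F" for f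
  proof -
    let ?fib = "{f' \<in> ?F. restrict f' ?X = restrict f ?X}"
    let ?N = "\<lambda>t. common_neighbours (f t) (f ((t + 2) mod m))"
    have "inj_on (\<lambda>f'. (f' ?i, f' ?j)) ?fib"
    proof (rule inj_onI)
      fix g h assume gh: "g \<in> ?fib" "h \<in> ?fib" "(g ?i, g ?j) = (h ?i, h ?j)"
      show "g = h"
      proof (rule PiE_eqI_restrict)
        show "g \<in> {..<m} \<rightarrow>\<^sub>E verts G" "h \<in> {..<m} \<rightarrow>\<^sub>E verts G"
          using gh F by auto
        show "restrict g ?X = restrict h ?X" using gh by simp
        show "g t = h t" if "t < m" "t \<notin> ?X" for t using gh(3) that by auto
      qed
    qed
    moreover have "(\<lambda>f'. (f' ?i, f' ?j)) ` ?fib \<subseteq> ?N i \<times> ?N j"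
    proof (rule image_subsetI)
      fix g assume g: "g \<in> ?fib"
      have same: "g t = f t" if "t \<in> ?X" for t
      proof -
        have "restrict g ?X t = restrict f ?X t" using g by simp
        then show ?thesis using that by simp
      qed
      have edge: "{g t, g (Suc t mod m)} \<in> edges G" if "t < m" for t
        using g that by (simp add: two_light_maps_def cycle_maps_def)
      have "Suc (Suc t mod m) mod m = (t + 2) mod m" for t by (simp add: mod_Suc_eq)
      then have "g (Suc t mod m) \<in> common_neighbours (g t) (g ((t + 2) mod m))" if "t < m" for t
        using edge [of t] edge [of "Suc t mod m"] that m by (simp add: common_neighbours_def)
      from this [OF ij(1)] this [OF ij(2)] show "(g ?i, g ?j) \<in> ?N i \<times> ?N j"
        by (simp only: same [OF ends(1)] same [OF ends(2)] same [OF ends(3)] same [OF ends(4)] mem_Times_iff fst_conv snd_conv)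
    qed
    ultimately have "card ?fib \<le> card (?N i \<times> ?N j)"
      by (rule card_inj_on_le) (simp add: finite_common_neighbours)
    also have "\<dots> \<le> D * D"
      using f by (simp add: card_cartesian_product two_light_maps_def heavy_def mult_le_mono)
    finally show ?thesis by (simp add: power2_eq_square)
  qed
  have "card ?F \<le> card ((\<lambda>f. restrict f ?X) ` ?F) * D\<^sup>2"
    by (rule card_le_fibres [OF finF fibre])
  also have "\<dots> \<le> ?n ^ card ?X * D\<^sup>2"
    by (intro mult_le_mono1 card_restriction_le [OF F]) auto
  also have "card ?X = m - 2" using m ij_neq by (subst card_Diff_subset) auto
  finally show ?thesis by (simp add: mult.commute)
qed

text \<open>If no two light positions are distinct and non-adjacent on the cycle, all of them lie in
  a pair of successive positions.\<close>

lemma cycle_maps_cover: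
  assumes m: "m \<ge> 4"
  shows "cycle_maps m \<subseteq> (\<Union>s<m. heavy_cycle_maps D m {s, Suc s mod m}) \<union>
    (\<Union>(i, j)\<in>{(i, j). i < m \<and> j < m \<and> i \<noteq> j \<and> j \<noteq> Suc i mod m \<and> i \<noteq> Suc j mod m}.
      two_light_maps D m i j)"
proof
  fix f assume f: "f \<in> cycle_maps m"
  define L where "L = {i. i < m \<and> \<not> heavy D (f i) (f ((i + 2) mod m))}"
  show "f \<in> (\<Union>s<m. heavy_cycle_maps D m {s, Suc s mod m}) \<union>
    (\<Union>(i, j)\<in>{(i, j). i < m \<and> j < m \<and> i \<noteq> j \<and> j \<noteq> Suc i mod m \<and> i \<noteq> Suc j mod m}.
      two_light_maps D m i j)"
  proof (cases "\<exists>i\<in>L. \<exists>j\<in>L. i \<noteq> j \<and> j \<noteq> Suc i mod m \<and> i \<noteq> Suc j mod m")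
    case True
    then show ?thesis using f by (fastforce simp: L_def two_light_maps_def)
  next
    case False
    have "\<exists>s<m. L \<subseteq> {s, Suc s mod m}"
    proof (cases "L = {}")
      case True
      then show ?thesis using m by (intro exI [of _ 0]) auto
    next
      case nonempty: False
      then obtain i where i: "i \<in> L" by blast
      show ?thesis
      proof (cases "\<exists>h\<in>L. i = Suc h mod m")
        case True
        then obtain h where h: "h \<in> L" "i = Suc h mod m" by blast
        have "t \<in> {h, Suc h mod m}" if t: "t \<in> L" for t
        proof (rule ccontr)
          assume "t \<notin> {h, Suc h mod m}"
          then have "t = Suc i mod m \<or> i = Suc t mod m" "h = Suc t mod m" "t \<noteq> h"
            using False i h t by auto
          moreover have "h < m" "t < m" using h t by (auto simp: L_def)
          \<comment> \<open>Modulo \<open>m\<close>, either \<open>t = h\<close>, or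
            \<open>t\<close> is both \<open>h + 2\<close> and \<open>h - 1\<close>; the latter would
            force \<open>m\<close> to divide 3.\<close>
          ultimately show False using h(2) m by (auto simp: mod_Suc split: if_splits)
        qed
        then show ?thesis using h by (auto simp: L_def)
      next
        case no_pred: False
        have "L \<subseteq> {i, Suc i mod m}" using False i no_pred by blast
        then show ?thesis using i by (auto simp: L_def)
      qed
    qed
    then show ?thesis using f by (auto simp: L_def heavy_cycle_maps_def)
  qed
qed

text \<open>There are \<open>m\<close> rotations of the heavy case and at most
  \<open>m\<^sup>2\<close> pairs of light positions, each contributing a constant times the same
  power of the number of vertices.\<close>

lemma card_copies_le:
  assumes l: "2 \<le> l" "l \<le> k"
    and free: "\<not> (\<exists>S\<in>copies (cycle_graph (2 * k + 1)) G. rainbow c S)"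
  defines "D \<equiv> 10 * k + 30" and "m \<equiv> 2 * l + 1"
  shows "card (copies (cycle_graph m) G) \<le> (m * (3 * D\<^sup>2) + m\<^sup>2 * D\<^sup>2) * card (verts G) ^ (2 * l - 1)"
proof -
  let ?n = "card (verts G) ^ (2 * l - 1)"
  let ?P = "{(i, j). i < m \<and> j < m \<and> i \<noteq> j \<and> j \<noteq> Suc i mod m \<and> i \<noteq> Suc j mod m}"
  have m: "m - 2 = 2 * l - 1" "m - 1 = 2 * l" "m \<ge> 4" using l by (simp_all add: m_def)
  have P: "?P \<subseteq> {..<m} \<times> {..<m}" by auto
  then have finP: "finite ?P" by (rule finite_subset) simp
  have "card ?P \<le> card ({..<m} \<times> {..<m})" by (rule card_mono [OF _ P]) simp
  then have cP: "card ?P \<le> m\<^sup>2" by (simp add: card_cartesian_product power2_eq_square)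
  have "card (copies (cycle_graph m) G) \<le> card (cycle_maps m)"
    by (rule card_copies_le_cycle_maps) (simp add: m_def)
  also have "\<dots> \<le> card ((\<Union>s<m. heavy_cycle_maps D m {s, Suc s mod m}) \<union>
      (\<Union>(i, j)\<in>?P. two_light_maps D m i j))"
  proof (rule card_mono [OF _ cycle_maps_cover [OF m(3)]])
    show "finite ((\<Union>s<m. heavy_cycle_maps D m {s, Suc s mod m}) \<union>
      (\<Union>(i, j)\<in>?P. two_light_maps D m i j))"
      by (rule finite_subset [OF _ finite_cycle_maps [of m]])
        (auto simp: heavy_cycle_maps_def two_light_maps_def)
  qed
  also have "\<dots> \<le> card (\<Union>s<m. heavy_cycle_maps D m {s, Suc s mod m}) +
      card (\<Union>(i, j)\<in>?P. two_light_maps D m i j)"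
    by (rule card_Un_le)
  also have "\<dots> \<le> m * (3 * D\<^sup>2 * ?n) + card ?P * (D\<^sup>2 * ?n)"
  proof (rule add_mono)
    have "card (heavy_cycle_maps D m {s, Suc s mod m}) \<le> 3 * D\<^sup>2 * ?n" if "s < m" for s
      using card_heavy_cycle_maps_rotate [of m s D] card_heavy_cycle_maps_final [OF l _ free, of D] that m
      by (simp add: m_def D_def)
    then have "(\<Sum>s<m. card (heavy_cycle_maps D m {s, Suc s mod m})) \<le> (\<Sum>s<m. 3 * D\<^sup>2 * ?n)"
      by (intro sum_mono) simp
    moreover have "card (\<Union>s<m. heavy_cycle_maps D m {s, Suc s mod m}) \<le>
        (\<Sum>s<m. card (heavy_cycle_maps D m {s, Suc s mod m}))"
      by (rule card_UN_le) simp
    ultimately show "card (\<Union>s<m. heavy_cycle_maps D m {s, Suc s mod m}) \<le> m * (3 * D\<^sup>2 * ?n)"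
      by simp
    have "(\<Sum>(i, j)\<in>?P. card (two_light_maps D m i j)) \<le> (\<Sum>_\<in>?P. D\<^sup>2 * ?n)"
    proof (rule sum_mono)
      fix t assume "t \<in> ?P"
      then show "(case t of (i, j) \<Rightarrow> card (two_light_maps D m i j)) \<le> D\<^sup>2 * ?n"
        using card_two_light_maps [of m "fst t" "snd t" D] m by (simp add: case_prod_beta)
    qed
    moreover have "card (\<Union>(i, j)\<in>?P. two_light_maps D m i j) \<le>
        (\<Sum>(i, j)\<in>?P. card (two_light_maps D m i j))"
      using card_UN_le [OF finP, of "\<lambda>(i, j). two_light_maps D m i j"] by (simp add: case_prod_beta)
    ultimately show "card (\<Union>(i, j)\<in>?P. two_light_maps D m i j) \<le> card ?P * (D\<^sup>2 * ?n)"
      by simp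
  qed
  also have "\<dots> \<le> m * (3 * D\<^sup>2 * ?n) + m\<^sup>2 * (D\<^sup>2 * ?n)"
    using cP by simp
  finally show ?thesis by (simp add: algebra_simps)
qed

end

subsection \<open>Lower bound\<close>

text \<open>Each sign occurs in exactly two factors. In other words, a cyclic sequence changes sign
  an even number of times.\<close>

lemma prod_sign_changes:
  fixes s :: "nat \<Rightarrow> int"
  assumes "m > 0" and "\<And>i. i < m \<Longrightarrow> s i = 1 \<or> s i = -1"
  shows "(\<Prod>i<m. s i * s (Suc i mod m)) = 1"
proof -
  have "(\<Prod>i<m. s (Suc i mod m)) = (\<Prod>i<m. s i)"
  proof (rule prod.reindex_bij_witness [of _ "\<lambda>i. if i = 0 then m - 1 else i - 1" "\<lambda>i. Suc i mod m"])
  qed (use assms(1) in \<open>auto simp: mod_Suc split: if_splits\<close>)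
  then have "(\<Prod>i<m. s i * s (Suc i mod m)) = (\<Prod>i<m. s i * s i)" by (simp add: prod.distrib)
  also have "\<dots> = (\<Prod>i<m. 1)" by (rule prod.cong) (use assms(2) in force)+
  finally show ?thesis by simp
qed

section \<open>The matched graph, its colouring and its cycles\<close>

text \<open>The classes A1, A2, B, A', B' are the successive intervals of length \<open>t\<close>
  starting at 0. The shift by \<open>3 * t\<close> takes A1 to A' and A2 to B'.\<close>

definition matching_edges :: "nat \<Rightarrow> nat set set" where
  "matching_edges t = (\<lambda>i. {i, i + 3 * t}) ` {..<2 * t}"

definition dense_edges :: "nat \<Rightarrow> nat set set" where
  "dense_edges t = {{i, j} | i j. i < 2 * t \<and> 2 * t \<le> j \<and> j < 3 * t \<or>
     3 * t \<le> i \<and> i < 4 * t \<and> 4 * t \<le> j \<and> j < 5 * t}"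

definition matched_graph :: "nat \<Rightarrow> nat \<Rightarrow> nat graph" where
  "matched_graph n t = ({..<n}, matching_edges t \<union> dense_edges t)"

text \<open>\<open>set_encode\<close> is injective on finite sets, so each dense edge has a colour
  of its own; \<open>Suc\<close> keeps it apart from the colour 0 of the matchings.\<close>

definition matched_colouring :: "nat \<Rightarrow> nat set \<Rightarrow> nat" where
  "matched_colouring t e = (if e \<in> matching_edges t then 0 else Suc (set_encode e))"

lemma simple_graph_matched_graph: "5 * t \<le> n \<Longrightarrow> simple_graph (matched_graph n t)"
  by (auto simp: simple_graph_def matched_graph_def matching_edges_def dense_edges_def card_insert_if)

lemma proper_matched_colouring: "proper_edge_colouring (matched_graph n t) (matched_colouring t)"
  unfolding proper_edge_colouring_def
proof (intro ballI impI)
  fix e e' assume e: "e \<in> edges (matched_graph n t)" "e' \<in> edges (matched_graph n t)"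
    and adj: "e \<noteq> e' \<and> e \<inter> e' \<noteq> {}"
  have fin: "finite e" "finite e'"
    using e by (auto simp: matched_graph_def matching_edges_def dense_edges_def)
  have "\<not> (e \<in> matching_edges t \<and> e' \<in> matching_edges t)"
    using adj by (auto simp: matching_edges_def)
  then show "matched_colouring t e \<noteq> matched_colouring t e'"
    using adj fin set_encode_eq by (auto simp: matched_colouring_def)
qed

text \<open>The dense parts and the edges \<open>{i, i + 3 * t}\<close> with \<open>i < t\<close> form a bipartite graph, so an odd
  cycle uses an edge \<open>{i, i + 3 * t}\<close> with \<open>i \<ge> t\<close>. All matching edges cross the cut at \<open>3 * t\<close>, so
  it uses a second matching edge, of the same colour.\<close>

lemma no_rainbow_odd_cycle:
  assumes S: "S \<in> copies (cycle_graph m) (matched_graph n t)" and m: "odd m" "m \<ge> 3"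
  shows "\<not> rainbow (matched_colouring t) S"
proof
  assume rb: "rainbow (matched_colouring t) S"
  obtain f where f: "bij_betw f {..<m} (verts S)"
    and edges: "edges S = (\<lambda>i. {f i, f (Suc i mod m)}) ` {..<m}"
    using S by (auto simp: copies_def graph_iso_def cycle_graph_def image_image)
  define e where "e i = {f i, f (Suc i mod m)}" for i
  have e: "e i \<in> matching_edges t \<union> dense_edges t" "e i \<in> edges S" if "i < m" for i
  proof -
    show "e i \<in> edges S" using that by (auto simp: edges e_def)
    then show "e i \<in> matching_edges t \<union> dense_edges t"
      using S by (auto simp: copies_def subgraph_def matched_graph_def)
  qed
  have f_eq: "f i = f j \<longleftrightarrow> i = j" if "i < m" "j < m" for i j
    using f that by (auto simp: bij_betw_def inj_on_def)
  have e_inj: "i = j" if "i < m" "j < m" "e i = e j" for i j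
  proof -
    have lt: "Suc i mod m < m" "Suc j mod m < m" using m by simp_all
    have "i = j \<or> i = Suc j mod m \<and> Suc i mod m = j"
      using that lt unfolding e_def doubleton_eq_iff by (auto simp: f_eq)
    \<comment> \<open>Being successors of each other modulo \<open>m\<close> would force
      \<open>m\<close> to divide 2.\<close>
    then show ?thesis using that m by (auto simp: mod_Suc split: if_splits)
  qed
  \<comment> \<open>\<open>u\<close> separates A1, A2 and B' from B and A': dense edges and the
    matching A1-A' change its sign, A2-B' does not. \<open>w\<close> is the cut at
    \<open>3 * t\<close>: matching edges change its sign, dense edges do not.\<close>
  define u where "u v = (if v < 2 * t \<or> 4 * t \<le> v then 1 else - 1 :: int)" for v
  define w where "w v = (if v < 3 * t then 1 else - 1 :: int)" for v
  have signs: "u v = 1 \<or> u v = - 1" "w v = 1 \<or> w v = - 1" for v by (simp_all add: u_def w_def)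
  have "\<exists>i0<m. u (f i0) * u (f (Suc i0 mod m)) \<noteq> -1"
  proof (rule ccontr)
    assume "\<not> ?thesis"
    then have "(\<Prod>i<m. u (f i) * u (f (Suc i mod m))) = (\<Prod>i<m. - 1)"
      by (intro prod.cong) auto
    also have "\<dots> = - 1" using m by simp
    finally show False using prod_sign_changes [of m "\<lambda>i. u (f i)"] signs m by simp
  qed
  then obtain i0 where i0: "i0 < m" "u (f i0) * u (f (Suc i0 mod m)) \<noteq> -1" by blast
  have "e i0 \<notin> dense_edges t"
    using i0(2) by (auto simp: dense_edges_def e_def u_def doubleton_eq_iff)
  then have match0: "e i0 \<in> matching_edges t" using e i0 by blast
  \<comment> \<open>Rainbowness makes \<open>e i0\<close> the only matching edge of the cycle, so
    \<open>w\<close> would change sign exactly once.\<close>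
  have "w (f i) * w (f (Suc i mod m)) = (if i = i0 then - 1 else 1)" if i: "i < m" for i
  proof (cases "i = i0")
    case True
    then show ?thesis using match0 by (auto simp: matching_edges_def e_def w_def doubleton_eq_iff)
  next
    case False
    have "e i \<notin> matching_edges t"
    proof
      assume "e i \<in> matching_edges t"
      then have "matched_colouring t (e i) = matched_colouring t (e i0)"
        using match0 by (simp add: matched_colouring_def)
      then have "e i = e i0" using rb e(2) i i0(1) by (auto simp: rainbow_def inj_on_def)
      then show False using False e_inj i i0(1) by blast
    qed
    then have "e i \<in> dense_edges t" using e(1) i by blast
    then show ?thesis using False by (auto simp: dense_edges_def e_def w_def doubleton_eq_iff)
  qed
  then have "(\<Prod>i<m. w (f i) * w (f (Suc i mod m))) = (\<Prod>i<m. if i = i0 then - 1 else 1)"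
    by (intro prod.cong) auto
  also have "\<dots> = - 1" using i0(1) by simp
  finally show False using prod_sign_changes [of m "\<lambda>i. w (f i)"] signs m by simp
qed

text \<open>The vertices \<open>0, \<dots>, 2 * l - 2\<close> of the cycle are chosen freely, each in its own block of size
  \<open>q\<close>; the last two are the partners of \<open>2 * l - 2\<close> and \<open>0\<close> in the matching.\<close>

definition block :: "nat \<Rightarrow> nat \<Rightarrow> nat" where
  "block l j = (if j = 0 then 0 else if j < 2 * l - 1 then (if even j then 2 * l else 4 * l) + j
     else if j = 2 * l - 1 then 10 * l - 2 else 6 * l)"

text \<open>A partner repeats the offset of the vertex it is matched to, and its block number is
  larger by \<open>6 * l\<close>. This is the shift by \<open>3 * t\<close> for
  \<open>t = 2 * l * q\<close>.\<close>

definition block_vertex :: "nat \<Rightarrow> nat \<Rightarrow> (nat \<Rightarrow> nat) \<Rightarrow> nat \<Rightarrow> nat" where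
  "block_vertex l q f j =
     q * block l j + f (if j < 2 * l - 1 then j else if j = 2 * l - 1 then 2 * l - 2 else 0)"

lemma block_eqD:
  "l \<ge> 2 \<Longrightarrow> i < 2 * l + 1 \<Longrightarrow> j < 2 * l + 1 \<Longrightarrow> block l i = block l j \<Longrightarrow> i = j"
  unfolding block_def by (auto split: if_splits elim!: evenE oddE)

lemma block_vertex_bounds:
  assumes f: "\<forall>j<2 * l - 1. f j < q" and l: "l \<ge> 2"
  shows "block_vertex l q f j div q = block l j"
    and "a \<le> block l j \<Longrightarrow> q * a \<le> block_vertex l q f j"
    and "block l j < b \<Longrightarrow> block_vertex l q f j < q * b"
proof -
  define x where "x = f (if j < 2 * l - 1 then j else if j = 2 * l - 1 then 2 * l - 2 else 0)"
  have "x < q" using f l by (simp add: x_def)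
  moreover have eq: "block_vertex l q f j = q * block l j + x" by (simp add: block_vertex_def x_def)
  ultimately show "block_vertex l q f j div q = block l j" by simp
  show "q * a \<le> block_vertex l q f j" if "a \<le> block l j"
    using mult_le_mono2 [OF that, of q] eq by linarith
  show "block_vertex l q f j < q * b" if "block l j < b"
    using mult_le_mono2 [of "Suc (block l j)" b q] that eq \<open>x < q\<close> by simp
qed

text \<open>The cycle starts in A1, alternates between B and A2 until position
  \<open>2 * l - 2\<close> in A2, takes a matching edge to B', a dense edge to A' and a matching
  edge back to A1.\<close>

lemma block_vertex_edge:
  assumes f: "\<forall>j<2 * l - 1. f j < q" and l: "l \<ge> 2" and j: "j < 2 * l + 1"
  shows "{block_vertex l q f j, block_vertex l q f (Suc j mod (2 * l + 1))}
    \<in> edges (matched_graph n (2 * l * q))"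
proof -
  let ?w = "block_vertex l q f" and ?t = "2 * l * q"
  note bounds = block_vertex_bounds(2,3) [OF f l]
  have A: "?w i < 2 * ?t" if "even i" "i < 2 * l - 1" for i
  proof -
    have "block l i < 4 * l" using that l by (auto simp: block_def)
    from bounds(2) [OF this] show ?thesis by (simp add: mult_ac)
  qed
  have B: "2 * ?t \<le> ?w i" "?w i < 3 * ?t" if "odd i" "i < 2 * l - 1" for i
  proof -
    have "i \<noteq> 0" using that by (cases i) auto
    then have "4 * l \<le> block l i" "block l i < 6 * l" using that l by (auto simp: block_def)
    from bounds(1) [OF this(1)] bounds(2) [OF this(2)]
    show "2 * ?t \<le> ?w i" "?w i < 3 * ?t" by (simp_all add: mult_ac)
  qed
  have "8 * l \<le> block l (2 * l - 1)" "block l (2 * l - 1) < 10 * l" using l by (auto simp: block_def)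
  from bounds(1) [OF this(1)] bounds(2) [OF this(2)]
  have B': "4 * ?t \<le> ?w (2 * l - 1)" "?w (2 * l - 1) < 5 * ?t" by (simp_all add: mult_ac)
  have "6 * l \<le> block l (2 * l)" "block l (2 * l) < 8 * l" using l by (auto simp: block_def)
  from bounds(1) [OF this(1)] bounds(2) [OF this(2)]
  have A': "3 * ?t \<le> ?w (2 * l)" "?w (2 * l) < 4 * ?t" by (simp_all add: mult_ac)
  have dense: "{x, y} \<in> edges (matched_graph n ?t)" "{y, x} \<in> edges (matched_graph n ?t)"
    if "x < 2 * ?t \<and> 2 * ?t \<le> y \<and> y < 3 * ?t \<or> 3 * ?t \<le> x \<and> x < 4 * ?t \<and> 4 * ?t \<le> y \<and> y < 5 * ?t" for x y
  proof -
    have "{x, y} \<in> dense_edges ?t" unfolding dense_edges_def using that by blast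
    then show "{x, y} \<in> edges (matched_graph n ?t)" "{y, x} \<in> edges (matched_graph n ?t)"
      by (simp_all add: matched_graph_def insert_commute)
  qed
  have matching: "{x, x + 3 * ?t} \<in> edges (matched_graph n ?t)" if "x < 2 * ?t" for x
    using that by (simp add: matched_graph_def matching_edges_def)
  consider "j < 2 * l - 2" "even j" | "j < 2 * l - 2" "odd j" | "j = 2 * l - 2" | "j = 2 * l - 1" | "j = 2 * l"
    using j by linarith
  then show ?thesis
  proof cases
    case 1
    then show ?thesis using dense(1) A [of j] B [of "Suc j"] by auto
  next
    case 2
    then show ?thesis using dense(2) A [of "Suc j"] B [of j] by auto
  next
    case 3
    have "block l (2 * l - 1) = block l (2 * l - 2) + 6 * l" using l by (auto simp: block_def)
    moreover have "?w (2 * l - 1) = q * block l (2 * l - 1) + f (2 * l - 2)"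
      "?w (2 * l - 2) = q * block l (2 * l - 2) + f (2 * l - 2)"
      using l by (auto simp: block_vertex_def)
    ultimately have "?w (2 * l - 1) = ?w (2 * l - 2) + 3 * ?t" by (simp add: distrib_left)
    moreover have "Suc j mod (2 * l + 1) = 2 * l - 1" using 3 l by simp
    ultimately show ?thesis using 3 matching A [of "2 * l - 2"] l by simp
  next
    case 4
    then show ?thesis using dense(2) A' B' l by simp
  next
    case 5
    have "?w (2 * l) = ?w 0 + 3 * ?t" using l by (auto simp: block_vertex_def block_def algebra_simps)
    then show ?thesis using 5 matching [of "?w 0"] A [of 0] l by (simp add: insert_commute)
  qed
qed

text \<open>The \<open>2 * l - 1\<close> free offsets take \<open>q\<close> values each, and
  different choices give different copies because a vertex reveals its position through its block.
  The five classes need \<open>10 * l * q\<close> vertices.\<close>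

lemma card_copies_matched_graph_ge:
  assumes l: "l \<ge> 2" and n: "10 * l * q \<le> n"
  shows "q ^ (2 * l - 1) \<le> card (copies (cycle_graph (2 * l + 1)) (matched_graph n (2 * l * q)))"
proof -
  let ?m = "2 * l + 1" and ?G = "matched_graph n (2 * l * q)" and ?w = "block_vertex l q"
  let ?F = "{..<2 * l - 1} \<rightarrow>\<^sub>E {..<q}"
  define copy where "copy f = (?w f ` {..<?m}, (\<lambda>i. {?w f i, ?w f (Suc i mod ?m)}) ` {..<?m})" for f
  have G: "simple_graph ?G" by (rule simple_graph_matched_graph) (use n in simp)
  have F: "\<forall>j<2 * l - 1. f j < q" if "f \<in> ?F" for f using that by auto
  have same: "i = j" if "f \<in> ?F" "g \<in> ?F" "i < ?m" "j < ?m" "?w f i = ?w g j" for f g i j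
    using that block_vertex_bounds(1) [of l f q i, OF F [OF that(1)] l]
      block_vertex_bounds(1) [of l g q j, OF F [OF that(2)] l] block_eqD [OF l that(3,4)] by simp
  have "inj_on copy ?F"
  proof (rule inj_onI)
    fix f g assume fg: "f \<in> ?F" "g \<in> ?F" "copy f = copy g"
    show "f = g"
    proof (rule PiE_ext [OF fg(1,2)])
      fix j assume j: "j \<in> {..<2 * l - 1}"
      have "?w f j \<in> ?w f ` {..<?m}" using j by auto
      \<comment> \<open>Comparing vertex sets is enough to recover the offsets.\<close>
      then have "?w f j \<in> ?w g ` {..<?m}" using fg(3) by (simp add: copy_def)
      then obtain i where "i < ?m" "?w f j = ?w g i" by auto
      then show "f j = g j" using same [OF fg(1,2), of j i] j by (simp add: block_vertex_def)
    qed
  qed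
  moreover have "copy ` ?F \<subseteq> copies (cycle_graph ?m) ?G"
  proof (rule image_subsetI)
    fix f assume f: "f \<in> ?F"
    have edges: "{?w f i, ?w f (Suc i mod ?m)} \<in> edges ?G" if "i < ?m" for i
      using block_vertex_edge [OF F [OF f] l that] .
    have "bij_betw (?w f) {..<?m} (?w f ` {..<?m})"
      using same [OF f f] by (intro bij_betw_imageI inj_onI) auto
    then have "graph_iso (cycle_graph ?m) (copy f)"
      unfolding graph_iso_def cycle_graph_def copy_def by (intro exI [of _ "?w f"]) (simp add: image_image)
    moreover have sub: "edges (copy f) \<subseteq> edges ?G" using edges by (auto simp: copy_def)
    moreover have "card e = 2" if "e \<in> edges (copy f)" for e
      using that sub G by (auto simp: simple_graph_def)
    moreover have "e \<subseteq> verts (copy f)" if "e \<in> edges (copy f)" for e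
      using that by (auto simp: copy_def)
    moreover have "verts (copy f) \<subseteq> verts ?G"
    proof
      fix v assume "v \<in> verts (copy f)"
      then obtain i where "i < ?m" "v = ?w f i" by (auto simp: copy_def)
      then show "v \<in> verts ?G" using edges [of i] G unfolding simple_graph_def by blast
    qed
    moreover have "finite (verts (copy f))" by (simp add: copy_def)
    ultimately show "copy f \<in> copies (cycle_graph ?m) ?G"
      by (simp add: copies_def subgraph_def simple_graph_def)
  qed
  moreover have "finite (copies (cycle_graph ?m) ?G)"
  proof (rule finite_subset)
    show "copies (cycle_graph ?m) ?G \<subseteq> Pow (verts ?G) \<times> Pow (edges ?G)"
      by (auto simp: copies_def subgraph_def)
    have "edges ?G \<subseteq> Pow (verts ?G)" "finite (verts ?G)" using G by (auto simp: simple_graph_def)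
    then show "finite (Pow (verts ?G) \<times> Pow (edges ?G))" by (simp add: finite_subset)
  qed
  ultimately have "card ?F \<le> card (copies (cycle_graph ?m) ?G)" by (rule card_inj_on_le)
  then show ?thesis by (simp add: card_funcsetE)
qed

theorem theorem3p1:
  fixes k l :: nat
  assumes "k \<ge> l" and "l \<ge> 2"
  shows "(\<lambda>n. real (ex_rainbow n (cycle_graph (2 * l + 1)) (cycle_graph (2 * k + 1))))
           \<in> \<Theta>(\<lambda>n. real n ^ (2 * l - 1))"
proof (rule bigthetaI)
  let ?ex = "\<lambda>n. ex_rainbow n (cycle_graph (2 * l + 1)) (cycle_graph (2 * k + 1))"
  let ?D = "10 * k + 30" and ?m = "2 * l + 1"
  let ?C = "?m * (3 * ?D\<^sup>2) + ?m\<^sup>2 * ?D\<^sup>2"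
  have "edges (cycle_graph (2 * k + 1)) \<noteq> {}" by (auto simp: cycle_graph_def)
  \<comment> \<open>The maximum is attained, so the upper bound may be proved for one extremal
    graph.\<close>
  then have "?ex n \<in> ex_counts n (cycle_graph ?m) (cycle_graph (2 * k + 1))" for n
    unfolding ex_rainbow_def by (intro Max_in finite_ex_counts ex_counts_nonempty)
  have upper: "?ex n \<le> ?C * n ^ (2 * l - 1)" for n
  proof -
    have "?ex n \<in> ex_counts n (cycle_graph ?m) (cycle_graph (2 * k + 1))" by fact
    then obtain G :: "nat graph" and c :: "nat set \<Rightarrow> nat" where G: "simple_graph G"
        "card (verts G) = n" "proper_edge_colouring G c" "?ex n = card (copies (cycle_graph ?m) G)"
      and free: "\<not> (\<exists>S\<in>copies (cycle_graph (2 * k + 1)) G. rainbow c S)"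
      by (auto simp: ex_counts_def)
    interpret coloured_graph G c using G by unfold_locales
    show ?thesis using card_copies_le [OF assms(2,1) free] G by simp
  qed
  show "(\<lambda>n. real (?ex n)) \<in> O(\<lambda>n. real n ^ (2 * l - 1))"
  proof (rule bigoI, rule always_eventually, rule allI)
    fix n
    show "norm (real (?ex n)) \<le> real ?C * norm (real n ^ (2 * l - 1))"
      using of_nat_mono [where 'a = real, OF upper [of n]] by simp
  qed
  have lower: "(n div (10 * l)) ^ (2 * l - 1) \<le> ?ex n" for n
  proof -
    let ?q = "n div (10 * l)"
    let ?G = "matched_graph n (2 * l * ?q)"
    have le: "10 * l * ?q \<le> n" by (rule times_div_less_eq_dividend)
    have "\<not> rainbow (matched_colouring (2 * l * ?q)) S" if "S \<in> copies (cycle_graph (2 * k + 1)) ?G" for S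
      using that by (rule no_rainbow_odd_cycle) (use assms in auto)
    moreover have "simple_graph ?G" by (rule simple_graph_matched_graph) (use le in linarith)
    moreover have "card (verts ?G) = n" by (simp add: matched_graph_def)
    ultimately have "card (copies (cycle_graph ?m) ?G) \<in> ex_counts n (cycle_graph ?m) (cycle_graph (2 * k + 1))"
      unfolding ex_counts_def using proper_matched_colouring by blast
    then have "card (copies (cycle_graph ?m) ?G) \<le> ?ex n"
      unfolding ex_rainbow_def by (rule Max_ge [OF finite_ex_counts])
    with card_copies_matched_graph_ge [OF assms(2) le] show ?thesis by (rule order_trans)
  qed
  show "(\<lambda>n. real (?ex n)) \<in> \<Omega>(\<lambda>n. real n ^ (2 * l - 1))"
  proof (rule landau_omega.bigI)
    \<comment> \<open>For \<open>n \<ge> 10 * l\<close> rounding down loses at most a factor 2, so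
      \<open>n div (10 * l)\<close> is at least \<open>n / (20 * l)\<close>.\<close>
    show "1 / (20 * real l) ^ (2 * l - 1) > 0" using assms(2) by simp
    show "\<forall>\<^sub>F n in at_top. norm (real (?ex n)) \<ge> 1 / (20 * real l) ^ (2 * l - 1) * norm (real n ^ (2 * l - 1))"
      using eventually_ge_at_top [of "10 * l"]
    proof eventually_elim
      case (elim n)
      let ?q = "n div (10 * l)"
      have "?q \<ge> 1" using elim assms(2) by (simp add: div_greater_zero_iff Suc_le_eq)
      have "n = 10 * l * ?q + n mod (10 * l)" by simp
      moreover have "n mod (10 * l) < 10 * l" using assms(2) by simp
      moreover have "10 * l * 1 \<le> 10 * l * ?q" using \<open>?q \<ge> 1\<close> by (rule mult_le_mono2)
      ultimately have "n \<le> 20 * l * ?q" by linarith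
      then have "n ^ (2 * l - 1) \<le> (20 * l) ^ (2 * l - 1) * ?q ^ (2 * l - 1)"
        by (metis power_mono power_mult_distrib zero_le)
      also have "\<dots> \<le> (20 * l) ^ (2 * l - 1) * ?ex n" by (rule mult_le_mono2 [OF lower])
      finally have "real (n ^ (2 * l - 1)) \<le> real ((20 * l) ^ (2 * l - 1) * ?ex n)"
        by (rule of_nat_mono)
      then have "real n ^ (2 * l - 1) \<le> real (?ex n) * (20 * real l) ^ (2 * l - 1)"
        by (simp add: mult.commute)
      moreover have "(20 * real l) ^ (2 * l - 1) > 0" using assms(2) by simp
      ultimately show ?case by (simp add: pos_divide_le_eq)
    qed
  qed
qed

end
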